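(* Let $(\Omega_1,\mathcal F_1,P_1)$ and $(\Omega_2,\mathcal F_2,P_2)$ be standard probability spaces, $V$ a borelogical space, and $X_1,X_2$ $V$-valued random variables on $\Omega_1,\Omega_2$ respectively. The following are equivalent: - (a) $P_1(X_1\in A)=P_2(X_2\in A)$ for all $A\in\Sigma$; - (b) there exists a probability measure $P$ on $\Omega_1\times\Omega_2$ with marginals $P_1,P_2$ such that $X_1(\omega_1)=X_2(\omega_2)$ for $P$-almost all $(\omega_1,\omega_2)$.
   Context: Borelogy. A borelogy on a set $V$ is a set $\mathsf B$ of maps $\mathbb R\to V$, called plots, such that: - (a) for every $b\in\mathsf B$, the set $\{(x,y): b(x)=b(y)\}$ is a Borel subset of $\mathbb R^2$; - (b) $b\circ f\in\mathsf B$ for every $b\in\mathsf B$ and every Borel function $f:\mathbb R\to\mathbb R$; - (c) there exists $b\in\mathsf B$ with $b(\mathbb R)=V$ and $\mathsf B=\{b\circ f: f:\mathbb R\to\mathbb R \text{ Borel}\}$. A borelogical space is a set with a borelogy. Its $\sigma$-field $\Sigma$ consists of all $A\subset V$ such that $b^{-1}(A)$ is Borel for every plot $b$. Random variables. A $V$-valued random variable on a standard probability space $\Omega$ is an equivalence class, modulo equality almost everywhere, of maps $X:\Omega\to V$ of the form $X=b\circ Y$, where $b$ is a plot and $Y:\Omega\to\mathbb R$ is a real random variable. *)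

theory Defs
  imports "HOL-Probability.Probability"
begin

text \<open>Standard probability space: a probability space isomorphic mod 0 to a Borel
probability measure on the real line (or its completion).\<close>
definition standard_prob_space :: "'a measure \<Rightarrow> bool" where
  "standard_prob_space M \<longleftrightarrow> prob_space M \<and>
     (\<exists>(\<mu>::real measure) f g. prob_space \<mu> \<and> sets \<mu> = sets borel \<and>
        f \<in> M \<rightarrow>\<^sub>M borel \<and> g \<in> completion \<mu> \<rightarrow>\<^sub>M M \<and>
        distr M borel f = \<mu> \<and> distr (completion \<mu>) M g = M \<and>
        (AE \<omega> in M. g (f \<omega>) = \<omega>) \<and> (AE x in \<mu>. f (g x) = x))"

definition borelogy :: "'v set \<Rightarrow> (real \<Rightarrow> 'v) set \<Rightarrow> bool" where
  "borelogy V B \<longleftrightarrow>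
     (\<forall>b\<in>B. range b \<subseteq> V) \<and>
     (\<forall>b\<in>B. {(x, y). b x = b y} \<in> sets (borel :: (real \<times> real) measure)) \<and>
     (\<forall>b\<in>B. \<forall>f \<in> borel_measurable (borel :: real measure). b \<circ> f \<in> B) \<and>
     (\<exists>b\<in>B. range b = V \<and> B = {b \<circ> f | f. f \<in> borel_measurable (borel :: real measure)})"

definition borelogy_sigma :: "'v set \<Rightarrow> (real \<Rightarrow> 'v) set \<Rightarrow> 'v set set" where
  "borelogy_sigma V B = {A. A \<subseteq> V \<and> (\<forall>b\<in>B. b -` A \<in> sets (borel :: real measure))}"

text \<open>A representative of a V-valued random variable on M: a map of the form b o Y
with b a plot and Y a real random variable (random variables are taken modulo
a.e. equality; all notions used below are invariant under a.e. modification).\<close>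
definition borelogy_rv :: "'v set \<Rightarrow> (real \<Rightarrow> 'v) set \<Rightarrow> 'a measure \<Rightarrow> ('a \<Rightarrow> 'v) \<Rightarrow> bool" where
  "borelogy_rv V B M X \<longleftrightarrow>
     (\<exists>b Y. b \<in> B \<and> Y \<in> borel_measurable M \<and> (\<forall>\<omega>\<in>space M. X \<omega> = b (Y \<omega>)))"

end

(* (b) implies (a) is immediate.  For (a) implies (b), transport both spaces to Borel probability
   measures mu, nu on the line; with a generating plot b, the relation E = {b x = b y} is a Borel
   equivalence relation, and X1 = X2 becomes a Borel set L = {(x, y). (phi x, psi y) : E}.
   Call (A, D) a cover of L if L lies in A x R Un R x D, of cost mu A + nu D.
   (i) The event "every cover costs more than t" is continuous along increasing unions, so by
   Choquet's capacitability argument it persists on compact sets decreasing into L.  On these,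
   greedy transport plans on finer and finer dyadic grids have a cluster point, a measure
   concentrated on L whose marginals are dominated by mu, nu and whose mass is at least t / 2.
   (ii) If mu, nu agree on E-invariant Borel sets, each cover of L costs at least the full mass:
   disjoint E-invariant analytic sets are separated by an E-invariant Borel set.
   (iii) Removing the subcoupling of (i) preserves the agreement on invariant sets and shrinks
   the remaining mass by a fixed factor; summing the subcouplings gives the coupling. *)

theory Submission
  imports Defs
begin

section \<open>Souslin sets and capacitability\<close>

text \<open>If \<open>V\<close> were a standard Borel space, the two variables could be coupled
  conditionally independently given their common value. A Borel equivalence relation need not allow
  this: for "x - y is rational" and Lebesgue measure on [0,1], invariant Borel sets are null or
  conull, so the conditional product is the full product measure, and the relation is null for it.
  The coupling has to come from a duality between mass carried by \<open>L\<close> and costs of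
  covers of \<open>L\<close>. Sharp duality is avoided: greedy plans lose a factor 2, which is
  harmless because the remainder is again a pair of the same kind. The other obstacle is that
  \<open>L\<close> is in general neither open nor closed, so weak limits of plans do not control it.
  Limits are therefore taken setwise, on all subsets of the plane at once. Only finite additivity
  survives; domination of the marginals restores countable additivity on rectangles, and
  concentration on \<open>L\<close> is recovered from sets whose complements are countable unions of
  rectangles.\<close>

definition souslin :: "'a::topological_space set \<Rightarrow> bool" where
  "souslin L \<longleftrightarrow> (\<exists>C :: ('a \<times> (nat \<Rightarrow> nat)) set. closed C \<and> L = fst ` C)"

lemma souslin_closed: "closed L \<Longrightarrow> souslin L"
  unfolding souslin_def
  by (intro exI[of _ "L \<times> UNIV"]) (auto intro: closed_Times)

lemma souslin_UN:
  fixes L :: "nat \<Rightarrow> 'a::topological_space set"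
  assumes "\<And>n. souslin (L n)"
  shows "souslin (\<Union>n. L n)"
proof -
  obtain C where C: "\<And>n. closed (C n)" "\<And>n. L n = fst ` (C n :: ('a \<times> (nat \<Rightarrow> nat)) set)"
    using assms unfolding souslin_def by metis
  \<comment> \<open>The first digit of \<open>s\<close> names the index of a set containing
    \<open>x\<close>; the remaining digits are the witness for that set.\<close>
  define D where "D = {(x, s). (x, \<lambda>k. s (Suc k)) \<in> C (s 0)}"
  have cont: "continuous_on UNIV (\<lambda>z::'a \<times> (nat \<Rightarrow> nat). (fst z, \<lambda>k. snd z (Suc k)))"
    by (intro continuous_intros continuous_on_coordinatewise_then_product continuous_on_product_then_coordinatewise)
  have "open ({z::'a \<times> (nat \<Rightarrow> nat). snd z 0 = n} \<inter> (\<lambda>z. (fst z, \<lambda>k. snd z (Suc k))) -` (- C n))" for n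
  proof (intro open_Int)
    have "continuous_on UNIV (\<lambda>z::'a \<times> (nat \<Rightarrow> nat). snd z 0)"
      by (intro continuous_intros continuous_on_product_then_coordinatewise)
    then have "open ((\<lambda>z::'a \<times> (nat \<Rightarrow> nat). snd z 0) -` {n})"
      by (rule open_vimage[rotated]) (rule discrete_topology_class.open_discrete)
    then show "open {z::'a \<times> (nat \<Rightarrow> nat). snd z 0 = n}"
      by (simp add: vimage_def)
    show "open ((\<lambda>z. (fst z, \<lambda>k. snd z (Suc k))) -` (- C n))"
      by (rule open_vimage[OF _ cont]) (use C in auto)
  qed
  then have "open (\<Union>n. {z::'a \<times> (nat \<Rightarrow> nat). snd z 0 = n} \<inter> (\<lambda>z. (fst z, \<lambda>k. snd z (Suc k))) -` (- C n))"
    by (intro open_UN) auto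
  also have "(\<Union>n. {z::'a \<times> (nat \<Rightarrow> nat). snd z 0 = n} \<inter> (\<lambda>z. (fst z, \<lambda>k. snd z (Suc k))) -` (- C n)) = - D"
    by (auto simp: D_def)
  finally have "closed D" by (simp add: closed_def)
  moreover have "(\<Union>n. L n) = fst ` D"
  proof safe
    fix x n assume "x \<in> L n"
    then obtain s where "(x, s) \<in> C n" by (auto simp: C)
    then have "(x, case_nat n s) \<in> D" by (simp add: D_def)
    then show "x \<in> fst ` D" by force
  next
    fix x s assume "(x, s) \<in> D"
    then show "fst (x, s) \<in> (\<Union>n. L n)" by (force simp: D_def C)
  qed
  ultimately show ?thesis unfolding souslin_def by blast
qed

lemma souslin_INT:
  fixes L :: "nat \<Rightarrow> 'a::topological_space set"
  assumes "\<And>n. souslin (L n)"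
  shows "souslin (\<Inter>n. L n)"
proof -
  obtain C where C: "\<And>n. closed (C n)" "\<And>n. L n = fst ` (C n :: ('a \<times> (nat \<Rightarrow> nat)) set)"
    using assms unfolding souslin_def by metis
  \<comment> \<open>One sequence carries a witness for every \<open>n\<close>:
    \<open>prod_encode\<close> splits its digits into rows, and row \<open>n\<close> testifies for
    \<open>L n\<close>.\<close>
  define D where "D = (\<Inter>n. (\<lambda>z. (fst z, \<lambda>k. snd z (prod_encode (n, k)))) -` C n)"
  have "closed D"
    unfolding D_def
  proof (intro closed_INT ballI closed_vimage C)
    show "continuous_on UNIV (\<lambda>z::'a \<times> (nat \<Rightarrow> nat). (fst z, \<lambda>k. snd z (prod_encode (n, k))))" for n
      by (intro continuous_intros continuous_on_coordinatewise_then_product continuous_on_product_then_coordinatewise)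
  qed
  moreover have "(\<Inter>n. L n) = fst ` D"
  proof safe
    fix x assume "x \<in> (\<Inter>n. L n)"
    then have "\<forall>n. \<exists>s. (x, s) \<in> C n" by (force simp: C)
    then obtain s where "\<And>n. (x, s n) \<in> C n" by metis
    then have "(x, \<lambda>i. case prod_decode i of (n, k) \<Rightarrow> s n k) \<in> D" by (simp add: D_def)
    then show "x \<in> fst ` D" by force
  next
    fix x s n assume "(x, s) \<in> D"
    then show "fst (x, s) \<in> L n" by (force simp: D_def C)
  qed
  ultimately show ?thesis unfolding souslin_def by blast
qed

lemma souslin_open:
  fixes L :: "'a::euclidean_space set"
  assumes "open L"
  shows "souslin L"
proof -
  obtain D where D: "countable D" "\<And>X. X \<in> D \<Longrightarrow> \<exists>a b. X = cbox a b" "\<Union>D = L"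
    using open_countable_Union_open_cbox[OF assms] by metis
  show ?thesis
  proof (cases "D = {}")
    case True
    then show ?thesis using D by (auto intro: souslin_closed)
  next
    case False
    have "souslin (from_nat_into D n)" for n
      using D(2)[OF from_nat_into[OF False, of n]] by (auto intro!: souslin_closed closed_cbox)
    then have "souslin (\<Union>n. from_nat_into D n)" by (rule souslin_UN)
    then show ?thesis using D False by simp
  qed
qed

lemma souslin_borel:
  fixes L :: "'a::euclidean_space set"
  assumes "L \<in> sets borel"
  shows "souslin L"
proof -
  have "L \<in> sigma_sets UNIV (Collect open)" using assms by (simp add: borel_def)
  \<comment> \<open>Analytic sets are not closed under complement, so the induction carries a set
    and its complement together.\<close>
  then have "souslin L \<and> souslin (- L)"
  proof induction
    case (Basic L)
    then show ?case by (auto intro: souslin_open souslin_closed)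
  next
    case Empty
    then show ?case by (auto intro: souslin_closed)
  next
    case (Compl L)
    then show ?case by (simp add: Compl_eq_Diff_UNIV[symmetric])
  next
    case (Union L)
    then show ?case by (auto intro: souslin_UN souslin_INT)
  qed
  then show ?thesis ..
qed

text \<open>\<open>\<Phi>\<close> stands for "the capacity exceeds a threshold". Nothing is assumed
  about decreasing compact sets, so a single compact subset of \<open>L\<close> satisfying
  \<open>\<Phi>\<close> cannot be promised. The decreasing sequence \<open>K\<close> is the
  substitute, and passing to the limit along it is left to each application.\<close>

lemma choquet_capacitability:
  fixes L :: "'a::euclidean_space set"
  assumes L: "L \<in> sets borel" and \<Phi>: "\<Phi> L"
    and mono: "\<And>A B. \<Phi> A \<Longrightarrow> A \<subseteq> B \<Longrightarrow> \<Phi> B"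
    and cont: "\<And>A. incseq A \<Longrightarrow> \<Phi> (\<Union>n::nat. A n) \<Longrightarrow> \<exists>n. \<Phi> (A n)"
  obtains K where "\<And>n::nat. compact (K n)" "decseq K" "\<And>n. \<Phi> (K n)" "(\<Inter>n. K n) \<subseteq> L"
proof -
  obtain C :: "('a \<times> (nat \<Rightarrow> nat)) set" where C: "closed C" "L = fst ` C"
    using souslin_borel[OF L] by (auto simp: souslin_def)
  have "incseq (\<lambda>n. fst ` C \<inter> cball 0 (real n))"
    by (auto simp: incseq_def intro: order_trans)
  moreover have "(\<Union>n. fst ` C \<inter> cball 0 (real n)) = L"
    using real_arch_simple by (auto simp: C)
  ultimately obtain j where j: "\<Phi> (fst ` C \<inter> cball 0 (real j))"
    using cont[of "\<lambda>n. fst ` C \<inter> cball 0 (real n)"] \<Phi> by auto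
  \<comment> \<open>Bounding the witness digits one after the other confines the witnesses to a
    compact part of Baire space. Raising the bound on the next digit exhausts \<open>T ms\<close>,
    so \<open>\<Phi>\<close> survives for some finite bound.\<close>
  define T where "T = (\<lambda>ms. fst ` {z\<in>C. norm (fst z) \<le> j \<and> (\<forall>i<length ms. snd z i \<le> ms ! i)})"
  have T0: "\<Phi> (T [])"
    by (rule mono[OF j]) (auto simp: T_def image_iff)
  have T_snoc: "T (ms @ [k]) = fst ` {z\<in>C. norm (fst z) \<le> j \<and> (\<forall>i<length ms. snd z i \<le> ms ! i)
      \<and> snd z (length ms) \<le> k}" for ms k
  proof -
    have "(\<forall>i<Suc (length ms). f i \<le> (ms @ [k]) ! i) \<longleftrightarrow>
        (\<forall>i<length ms. f i \<le> ms ! i) \<and> f (length ms) \<le> k" for f :: "nat \<Rightarrow> nat"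
      by (auto simp: All_less_Suc nth_append)
    then show ?thesis by (simp add: T_def)
  qed
  have step: "\<exists>m. \<Phi> (T (ms @ [m]))" if "\<Phi> (T ms)" for ms
  proof -
    have "incseq (\<lambda>m. T (ms @ [m]))"
      unfolding incseq_def T_snoc by (intro allI impI image_mono) auto
    moreover have "(\<Union>m. T (ms @ [m])) = T ms"
      unfolding T_snoc image_UN[symmetric] unfolding T_def by (rule arg_cong[where f="image fst"]) auto
    ultimately show ?thesis using cont[of "\<lambda>m. T (ms @ [m])"] that by auto
  qed
  define nxt where "nxt ms = (SOME m. \<Phi> (T (ms @ [m])))" for ms
  define pre where "pre = rec_nat [] (\<lambda>_ ms. ms @ [nxt ms])"
  have pre: "pre 0 = []" "\<And>n. pre (Suc n) = pre n @ [nxt (pre n)]" by (auto simp: pre_def)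
  have len: "length (pre n) = n" for n by (induction n) (auto simp: pre)
  define m where "m n = nxt (pre n)" for n
  have nth: "i < n \<Longrightarrow> pre n ! i = m i" for i n
    by (induction n) (auto simp: pre nth_append len m_def less_Suc_eq)
  have \<Phi>T: "\<Phi> (T (pre n))" for n
  proof (induction n)
    case (Suc n)
    then show ?case unfolding pre nxt_def by (rule someI_ex[OF step])
  qed (simp add: pre T0)
  have T_eq: "T (pre n) = fst ` {z\<in>C. norm (fst z) \<le> j \<and> (\<forall>i<n. snd z i \<le> m i)}" for n
    by (auto simp: T_def len nth)
  define K where "K n = closure (T (pre n))" for n
  have bdd: "T (pre n) \<subseteq> cball 0 (real j)" for n by (auto simp: T_eq)
  show ?thesis
  proof
    show "compact (K n)" for n
      using bounded_subset[OF bounded_cball bdd] by (simp add: K_def)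
    show "decseq K"
      unfolding decseq_def K_def T_eq by (intro allI impI closure_mono image_mono) auto
    show "\<Phi> (K n)" for n
      unfolding K_def by (rule mono[OF \<Phi>T closure_subset])
    show "(\<Inter>n. K n) \<subseteq> L"
    proof
      fix x assume "x \<in> (\<Inter>n. K n)"
      then have *: "\<exists>y\<in>T (pre n). dist y x < inverse (Suc n)" for n
        by (auto simp: K_def closure_approachable)
      then have "\<exists>y s. (y, s) \<in> C \<and> (\<forall>i<n. s i \<le> m i) \<and> dist y x < inverse (Suc n)" for n
      proof -
        obtain y where y: "y \<in> T (pre n)" "dist y x < inverse (Suc n)"
          using *[of n] by blast
        then obtain z where "z \<in> C" "y = fst z" "\<forall>i<n. snd z i \<le> m i" by (auto simp: T_eq)
        with y(2) show ?thesis by (intro exI[of _ "fst z"] exI[of _ "snd z"]) simp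
      qed
      then obtain y s where ys: "\<And>n. (y n, s n) \<in> C" "\<And>n i. i < n \<Longrightarrow> s n i \<le> m i"
        "\<And>n. dist (y n) x < inverse (Suc n)" by metis
      have y: "y \<longlonglongrightarrow> x"
        unfolding tendsto_dist_iff[of y]
        by (rule tendsto_sandwich[OF _ _ tendsto_const LIMSEQ_inverse_real_of_nat])
           (use ys(3) in \<open>auto intro!: always_eventually less_imp_le\<close>)
      have "compact (PiE UNIV (\<lambda>i. {..m i}))"
        using compactin_PiE[of "\<lambda>i. euclidean :: nat topology" UNIV "\<lambda>i. {..m i}"]
        by (simp add: euclidean_product_topology finite_imp_compact)
      then have "seq_compact (PiE UNIV (\<lambda>i. {..m i}))" by (rule compact_imp_seq_compact)
      \<comment> \<open>Only the first \<open>n\<close> digits of \<open>s n\<close> are known to be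
        bounded. Truncation by \<open>min\<close> puts the whole sequence into the compact product
        and can alter digit \<open>i\<close> only when \<open>n \<le> i\<close>, so it does not
        change the limits.\<close>
      moreover have "\<forall>n. (\<lambda>i. min (s n i) (m i)) \<in> PiE UNIV (\<lambda>i. {..m i})" by auto
      ultimately obtain l r where r: "strict_mono r" "((\<lambda>n i. min (s n i) (m i)) \<circ> r) \<longlonglongrightarrow> l"
        by (rule seq_compactE)
      have "(\<lambda>n. s (r n) i) \<longlonglongrightarrow> l i" for i
      proof -
        have "(\<lambda>n. min (s (r n) i) (m i)) \<longlonglongrightarrow> l i"
          using continuous_on_tendsto_compose[OF continuous_on_product_coordinates r(2)]
          by (simp add: o_def)
        moreover have "\<forall>\<^sub>F n in sequentially. min (s (r n) i) (m i) = s (r n) i"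
          using eventually_gt_at_top[of i]
        proof eventually_elim
          case (elim n)
          then have "i < r n" using seq_suble[OF r(1), of n] by linarith
          then show ?case using ys(2) by simp
        qed
        ultimately show ?thesis by (rule Lim_transform_eventually)
      qed
      then have "(\<lambda>n. s (r n)) \<longlonglongrightarrow> l"
        using limitin_componentwise[of "\<lambda>_. euclidean" UNIV "\<lambda>n. s (r n)" l sequentially]
        by (simp add: euclidean_product_topology)
      moreover have "(\<lambda>n. y (r n)) \<longlonglongrightarrow> x"
        using LIMSEQ_subseq_LIMSEQ[OF y r(1)] by (simp add: o_def)
      ultimately have "(\<lambda>n. (y (r n), s (r n))) \<longlonglongrightarrow> (x, l)" by (intro tendsto_Pair)
      then have "(x, l) \<in> C" by (rule closed_sequentially[OF C(1), rotated]) (simp add: ys(1))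
      then show "x \<in> L" by (force simp: C(2))
    qed
  qed
qed

section \<open>Costs of covers by strips\<close>

text \<open>The measure analogue of vertex covers of a bipartite graph with edge set
  \<open>L\<close>. A measure on \<open>L\<close> whose marginals are at most \<open>M\<close> and
  \<open>N\<close> has mass at most the cost of any cover; the subcouplings constructed later are a
  partial converse.\<close>

definition covers :: "'a measure \<Rightarrow> 'b measure \<Rightarrow> ('a \<times> 'b) set \<Rightarrow> ('a set \<times> 'b set) set" where
  "covers M N L = {(A, D). A \<in> sets M \<and> D \<in> sets N \<and> (\<forall>(x, y)\<in>L. x \<in> A \<or> y \<in> D)}"

definition cover_cost :: "'a measure \<Rightarrow> 'b measure \<Rightarrow> 'a set \<times> 'b set \<Rightarrow> real" where
  "cover_cost M N = (\<lambda>(A, D). measure M A + measure N D)"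

text \<open>If \<open>(A, D)\<close> and \<open>(A', D')\<close> cover a set, then so do both
  combinations on the left. Covers thus form a lattice, and the cost is modular on it.\<close>

lemma cover_cost_modular:
  assumes "finite_measure M" "finite_measure N"
    and "A \<in> sets M" "A' \<in> sets M" "D \<in> sets N" "D' \<in> sets N"
  shows "cover_cost M N (A \<union> A', D \<inter> D') + cover_cost M N (A \<inter> A', D \<union> D') =
    cover_cost M N (A, D) + cover_cost M N (A', D')"
proof -
  interpret M: finite_measure M by fact
  interpret N: finite_measure N by fact
  show ?thesis
    using measure_Un3[of A M A'] measure_Un3[of D N D'] assms
    by (simp add: cover_cost_def M.fmeasurable_eq_sets N.fmeasurable_eq_sets)
qed

text \<open>The near-optimal covers \<open>(A k, D k)\<close> of \<open>L k\<close> are combined into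
  \<open>(limsup A, liminf D)\<close>; modularity of the cost controls the error when the
  finite combinations are built from the right, because every intermediate pair still covers \<open>L n\<close>.\<close>
lemma cover_cost_continuous:
  fixes L :: "nat \<Rightarrow> ('a \<times> 'b) set"
  assumes M: "finite_measure M" and N: "finite_measure N"
    and L: "incseq L"
    and t: "\<And>n. \<exists>C \<in> covers M N (L n). cover_cost M N C \<le> t"
  shows "\<exists>C \<in> covers M N (\<Union>n. L n). cover_cost M N C \<le> t"
proof -
  interpret M: finite_measure M by fact
  interpret N: finite_measure N by fact
  define c where "c n = Inf (cover_cost M N ` covers M N (L n))" for n
  have nonneg: "0 \<le> cover_cost M N C" for C by (auto simp: cover_cost_def split: prod.splits)
  have bdd: "bdd_below (cover_cost M N ` X)" for X
    using nonneg by (intro bdd_belowI[of _ 0]) auto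
  have c_le: "c n \<le> cover_cost M N C" if "C \<in> covers M N (L n)" for n C
    unfolding c_def using bdd that by (intro cInf_lower) auto
  have ne: "covers M N (L n) \<noteq> {}" for n using t by blast
  have inc: "incseq c"
    unfolding incseq_def c_def
  proof (intro allI impI cInf_superset_mono image_mono bdd)
    fix m n :: nat assume "m \<le> n"
    then have "L m \<subseteq> L n" using L by (simp add: incseqD)
    then show "covers M N (L n) \<subseteq> covers M N (L m)" by (auto simp: covers_def)
  qed (use ne in auto)
  have ct: "c n \<le> t" for n using t[of n] c_le[of _ n] by (meson order_trans)
  obtain s where s: "c \<longlonglongrightarrow> s" "\<And>n. c n \<le> s"
    using incseq_convergent[OF inc] ct by blast
  have st: "s \<le> t" using LIMSEQ_le_const2[OF s(1)] ct by blast
  define e :: "nat \<Rightarrow> real" where "e n = (1/2)^n" for n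
  have e_pos: "0 < e n" for n by (simp add: e_def)
  have e_lim: "e \<longlonglongrightarrow> 0" unfolding e_def by (intro LIMSEQ_power_zero) auto
  have "\<exists>m. \<forall>n\<ge>m. s - e k < c n" for k
    using order_tendstoD(1)[OF s(1), of "s - e k"] e_pos[of k]
    by (auto simp: eventually_sequentially)
  then obtain m where m: "\<And>k n. m k \<le> n \<Longrightarrow> s - e k < c n" by metis
  \<comment> \<open>An increasing choice of indices above \<open>m\<close>, which puts the optimal
    cost \<open>c (r k)\<close> within \<open>e k\<close> of its limit \<open>s\<close>.\<close>
  define r where "r k = k + (\<Sum>i\<le>k. m i)" for k
  have r_m: "m k \<le> r k" for k unfolding r_def by (intro trans_le_add2 member_le_sum) auto
  have r_mono: "r j \<le> r k" if "j \<le> k" for j k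
    unfolding r_def using that by (intro add_mono sum_mono2) auto
  have cr: "s - e k < c (r k)" for k using m r_m by blast
  have "\<exists>C\<in>covers M N (L (r k)). cover_cost M N C < s + e k" for k
  proof -
    have "c (r k) < s + e k" using s(2)[of "r k"] e_pos[of k] by linarith
    then show ?thesis unfolding c_def using ne bdd by (subst (asm) cInf_less_iff) auto
  qed
  then have "\<forall>k. \<exists>A D. (A, D) \<in> covers M N (L (r k)) \<and> cover_cost M N (A, D) < s + e k" by force
  then obtain A D where AD: "\<And>k. (A k, D k) \<in> covers M N (L (r k))"
    "\<And>k. cover_cost M N (A k, D k) < s + e k" by metis
  have meas[measurable]: "A k \<in> sets M" "D k \<in> sets N" for k using AD by (auto simp: covers_def)
  have cov: "x \<in> A k \<or> y \<in> D k" if "(x, y) \<in> L (r n)" "n \<le> k" for n k x y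
    using AD(1)[of k] that incseqD[OF L r_mono[OF that(2)]] by (auto simp: covers_def)
  define U where "U n j = (\<Union>k\<in>{n..n+j}. A k)" for n j
  define W where "W n j = (\<Inter>k\<in>{n..n+j}. D k)" for n j
  have UW_meas[measurable]: "U n j \<in> sets M" "W n j \<in> sets N" for n j
    by (auto simp: U_def W_def)
  \<comment> \<open>Adding \<open>A n\<close> and \<open>D n\<close> on the left costs at most
    \<open>2 * e n\<close> more: \<open>e n\<close> for the near-optimal pair and \<open>e n\<close>
    because the complementary combination still covers \<open>L (r n)\<close>. Since
    \<open>e (Suc n) = e n / 2\<close>, the constant 4 reproduces itself: 4/2 + 2 = 4.\<close>
  have cost: "cover_cost M N (U n j, W n j) \<le> s + 4 * e n" for n j
  proof (induction j arbitrary: n)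
    case 0
    then show ?case using AD(2)[of n] e_pos[of n] by (simp add: U_def W_def)
  next
    case (Suc j)
    have split: "{n..n + Suc j} = insert n {Suc n..Suc n + j}" by auto
    have U: "U n (Suc j) = A n \<union> U (Suc n) j" and W: "W n (Suc j) = D n \<inter> W (Suc n) j"
      unfolding U_def W_def split by auto
    have "(A n \<inter> U (Suc n) j, D n \<union> W (Suc n) j) \<in> covers M N (L (r n))"
      unfolding covers_def
    proof (safe)
      fix x y assume xy: "(x, y) \<in> L (r n)" "y \<notin> D n" "y \<notin> W (Suc n) j"
      then obtain k where "k \<in> {Suc n..Suc n + j}" "y \<notin> D k" by (auto simp: W_def)
      then have "x \<in> U (Suc n) j" using cov[OF xy(1), of k] by (auto simp: U_def)
      then show "x \<in> U (Suc n) j" .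
    next
      fix x y assume xy: "(x, y) \<in> L (r n)" "y \<notin> D n"
      then show "x \<in> A n" using cov[OF xy(1), of n] by auto
    qed measurable
    then have "s - e n < cover_cost M N (A n \<inter> U (Suc n) j, D n \<union> W (Suc n) j)"
      using c_le[of _ "r n"] cr[of n] by fastforce
    moreover have "e (Suc n) = e n / 2" by (simp add: e_def)
    ultimately show ?case
      using Suc.IH[of "Suc n"] AD(2)[of n] cover_cost_modular[OF M N, of "A n" "U (Suc n) j" "D n" "W (Suc n) j"]
      unfolding U W by auto
  qed
  define U' where "U' n = (\<Union>k\<in>{n..}. A k)" for n
  define W' where "W' n = (\<Inter>k\<in>{n..}. D k)" for n
  have UW'[measurable]: "U' n \<in> sets M" "W' n \<in> sets N" for n
    by (auto simp: U'_def W'_def intro!: sets.countable_INT')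
  have cost': "cover_cost M N (U' n, W' n) \<le> s + 4 * e n" for n
  proof -
    have split: "{n..} = (\<Union>j. {n..n + j})"
      using le_Suc_ex by fastforce
    have "(\<Union>j. U n j) = U' n" "(\<Inter>j. W n j) = W' n"
      unfolding U_def W_def U'_def W'_def split by blast+
    moreover have "incseq (U n)" unfolding U_def incseq_def by (intro allI impI UN_mono) auto
    moreover have "decseq (W n)" unfolding W_def decseq_def by (intro allI impI INF_superset_mono) auto
    ultimately have "(\<lambda>j. measure M (U n j)) \<longlonglongrightarrow> measure M (U' n)"
      "(\<lambda>j. measure N (W n j)) \<longlonglongrightarrow> measure N (W' n)"
      using M.finite_Lim_measure_incseq[of "U n"] N.finite_Lim_measure_decseq[of "W n"] UW_meas
      by (auto simp: image_subset_iff)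
    then have "(\<lambda>j. cover_cost M N (U n j, W n j)) \<longlonglongrightarrow> cover_cost M N (U' n, W' n)"
      unfolding cover_cost_def by (auto intro!: tendsto_intros)
    then show ?thesis by (rule LIMSEQ_le_const2) (use cost in auto)
  qed
  have "decseq U'" unfolding U'_def decseq_def by (intro allI impI UN_mono) auto
  moreover have "incseq W'" unfolding W'_def incseq_def by (intro allI impI INF_superset_mono) auto
  ultimately have "(\<lambda>n. measure M (U' n)) \<longlonglongrightarrow> measure M (\<Inter>n. U' n)"
      "(\<lambda>n. measure N (W' n)) \<longlonglongrightarrow> measure N (\<Union>n. W' n)"
    using M.finite_Lim_measure_decseq[of U'] N.finite_Lim_measure_incseq[of W'] UW' by (auto simp: image_subset_iff)
  then have "(\<lambda>n. cover_cost M N (U' n, W' n)) \<longlonglongrightarrow> cover_cost M N (\<Inter>n. U' n, \<Union>n. W' n)"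
    unfolding cover_cost_def by (auto intro!: tendsto_intros)
  moreover have "(\<lambda>n. s + 4 * e n) \<longlonglongrightarrow> s + 4 * 0" by (intro tendsto_intros e_lim)
  ultimately have "cover_cost M N (\<Inter>n. U' n, \<Union>n. W' n) \<le> s + 4 * 0"
    by (rule LIMSEQ_le) (use cost' in auto)
  moreover have "(\<Inter>n. U' n, \<Union>n. W' n) \<in> covers M N (\<Union>n. L n)"
    unfolding covers_def
  proof safe
    fix x y n i assume xy: "(x, y) \<in> L n" "y \<notin> (\<Union>n. W' n)"
    \<comment> \<open>The index must be at least \<open>n\<close>, so that all later pairs cover the
      point, and at least \<open>i\<close>, so that the \<open>k\<close> found below lies in the
      tail that defines \<open>U' i\<close>.\<close>
    have "(x, y) \<in> L (r (max n i))"
      using xy(1) incseqD[OF L, of n "r (max n i)"] trans_le_add1[OF max.cobounded1]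
      unfolding r_def by blast
    moreover obtain k where "max n i \<le> k" "y \<notin> D k"
      using xy(2) unfolding W'_def by blast
    ultimately show "x \<in> U' i" using cov[of x y "max n i" k] by (auto simp: U'_def)
  qed measurable
  ultimately show ?thesis using st by force
qed

section \<open>Separation of analytic sets\<close>

text \<open>Lusin's separation theorem, read as a capacitability statement: "not separable by a
  Borel set" is monotone and continuous along increasing unions. If it held for \<open>P\<close> and
  \<open>Q\<close>, it would hold on compact sets decreasing into them, and compactness would yield
  a common point of the projections.\<close>

lemma borel_separation_of_projections:
  fixes P Q :: "('a::euclidean_space \<times> 'b::euclidean_space) set"
  assumes P: "P \<in> sets borel" and Q: "Q \<in> sets borel" and disj: "snd ` P \<inter> snd ` Q = {}"
  obtains S where "S \<in> sets borel" "snd ` P \<subseteq> S" "S \<inter> snd ` Q = {}"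
proof -
  \<comment> \<open>The last coordinate encodes the disjoint union of \<open>P\<close> and \<open>Q\<close>, so that capacitability
    is applied to a single set.\<close>
  define sep :: "'b set \<Rightarrow> (('a \<times> 'b) \<times> real) set \<Rightarrow> bool"
    where "sep S Z \<longleftrightarrow> (\<forall>w. ((w, 0) \<in> Z \<longrightarrow> snd w \<in> S) \<and> ((w, 1) \<in> Z \<longrightarrow> snd w \<notin> S))" for S Z
  define \<Phi> where "\<Phi> Z \<longleftrightarrow> \<not> (\<exists>S \<in> sets borel. sep S Z)" for Z
  define Z where "Z = P \<times> {0::real} \<union> Q \<times> {1}"
  have "P \<times> {0::real} \<in> sets (borel \<Otimes>\<^sub>M borel)" "Q \<times> {1::real} \<in> sets (borel \<Otimes>\<^sub>M borel)"
    using P Q by auto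
  then have Z: "Z \<in> sets borel" unfolding Z_def borel_prod by auto
  have "\<not> \<Phi> Z"
  proof
    assume "\<Phi> Z"
    have mono: "\<Phi> B" if "\<Phi> A" "A \<subseteq> B" for A B
      using that unfolding \<Phi>_def sep_def by blast
    have cont: "\<exists>n. \<Phi> (A n)" if A: "incseq A" "\<Phi> (\<Union>n::nat. A n)" for A
    proof (rule ccontr)
      assume "\<nexists>n. \<Phi> (A n)"
      then obtain S where S: "\<And>n. S n \<in> sets borel" "\<And>n. sep (S n) (A n)"
        unfolding \<Phi>_def by metis
      have *: "z \<in> A k" if "z \<in> A n" "n \<le> k" for z n k
        using that incseqD[OF A(1)] by blast
      \<comment> \<open>The lower limit of the separators works because \<open>S k\<close> separates
        all of \<open>A n\<close> as soon as \<open>k\<close> is at least \<open>n\<close>: a point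
        with tag 0 projects into all late \<open>S k\<close>, a point with tag 1 into none of
        them.\<close>
      have "sep (\<Union>n. \<Inter>k\<in>{n..}. S k) (\<Union>n. A n)"
        unfolding sep_def
      proof (intro allI conjI impI)
        fix w assume "(w, 0) \<in> (\<Union>n. A n)"
        then show "snd w \<in> (\<Union>n. \<Inter>k\<in>{n..}. S k)" using S(2) * unfolding sep_def by blast
      next
        fix w assume "(w, 1) \<in> (\<Union>n. A n)"
        then obtain n where n: "(w, 1) \<in> A n" by blast
        show "snd w \<notin> (\<Union>n. \<Inter>k\<in>{n..}. S k)"
        proof
          assume "snd w \<in> (\<Union>n. \<Inter>k\<in>{n..}. S k)"
          then obtain m where "\<forall>k\<in>{m..}. snd w \<in> S k" by blast
          then have "snd w \<in> S (max n m)" by auto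
          then show False using S(2)[of "max n m"] *[OF n, of "max n m"] unfolding sep_def by auto
        qed
      qed
      moreover have "(\<Union>n. \<Inter>k\<in>{n..}. S k) \<in> sets borel"
        using S(1) by (intro sets.countable_UN'' sets.countable_INT') auto
      ultimately show False using A(2) unfolding \<Phi>_def by blast
    qed
    obtain K where K: "\<And>n::nat. compact (K n)" "decseq K" "\<And>n. \<Phi> (K n)" "(\<Inter>n. K n) \<subseteq> Z"
      by (rule choquet_capacitability[of Z \<Phi>, OF Z \<open>\<Phi> Z\<close>]) (blast intro: mono cont)+
    define J where "J c n = (\<lambda>z. snd (fst z)) ` (K n \<inter> UNIV \<times> {c})" for c n
    have J: "compact (J c n)" for c n
      unfolding J_def
      by (intro compact_continuous_image continuous_intros compact_Int_closed K closed_Times closed_UNIV closed_singleton)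
    have Kmono: "K n \<subseteq> K m" if "m \<le> n" for m n using K(2) that by (simp add: decseqD)
    \<comment> \<open>Were the two compact projections disjoint, \<open>J 0 n\<close> itself would
      be a Borel separator for \<open>K n\<close>.\<close>
    have "J 0 n \<inter> J 1 n \<noteq> {}" for n
    proof
      assume "J 0 n \<inter> J 1 n = {}"
      moreover have "snd w \<in> J c n" if "(w, c) \<in> K n" for w c
        unfolding J_def using that by (intro image_eqI[of _ _ "(w, c)"]) auto
      ultimately have "sep (J 0 n) (K n)" unfolding sep_def by blast
      then show False using K(3)[of n] borel_closed[OF compact_imp_closed[OF J]] unfolding \<Phi>_def by blast
    qed
    moreover have "J c n \<subseteq> J c m" if "m \<le> n" for c m n
      unfolding J_def using Kmono[OF that] by (intro image_mono) auto
    ultimately have "\<Inter> (range (\<lambda>n. J 0 n \<inter> J 1 n)) \<noteq> {}"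
      by (intro compact_nest compact_Int J) blast+
    then obtain y where y: "\<And>n. y \<in> J 0 n" "\<And>n. y \<in> J 1 n" by blast
    \<comment> \<open>Lying in every projection does not by itself give one preimage common to all
      \<open>K n\<close>; compactness of the decreasing fibres over \<open>y\<close> provides
      it.\<close>
    have hit: "\<exists>w. (w, c) \<in> Z \<and> snd w = y" if "\<And>n. y \<in> J c n" for c
    proof -
      have "\<Inter> (range (\<lambda>n. K n \<inter> (UNIV \<times> {y}) \<times> {c})) \<noteq> {}"
      proof (rule compact_nest)
        show "compact (K n \<inter> (UNIV \<times> {y}) \<times> {c})" for n
          by (intro compact_Int_closed K closed_Times) auto
        show "K n \<inter> (UNIV \<times> {y}) \<times> {c} \<noteq> {}" for n
          using that[of n] unfolding J_def by force
        show "K n \<inter> (UNIV \<times> {y}) \<times> {c} \<subseteq> K m \<inter> (UNIV \<times> {y}) \<times> {c}" if "m \<le> n" for m n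
          using Kmono[OF that] by blast
      qed
      then obtain x where "\<And>n. ((x, y), c) \<in> K n" by auto
      then show ?thesis using K(4) by (intro exI[of _ "(x, y)"]) auto
    qed
    obtain w w' where "(w, 0) \<in> Z" "snd w = y" "(w', 1) \<in> Z" "snd w' = y"
      using hit[OF y(1)] hit[OF y(2)] by blast
    then have "w \<in> P" "w' \<in> Q" "snd w = snd w'" by (auto simp: Z_def)
    then show False using disj by (metis IntI empty_iff imageI)
  qed
  then obtain S where "S \<in> sets borel" "sep S Z" unfolding \<Phi>_def by blast
  then show ?thesis by (intro that[of S]) (auto simp: sep_def Z_def)
qed

lemma invariant_borel_separation:
  fixes E P Q :: "('a::euclidean_space \<times> 'a) set"
  assumes E: "E \<in> sets borel" "equiv UNIV E"
    and P: "P \<in> sets borel" and Q: "Q \<in> sets borel"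
    and disj: "snd ` P \<inter> snd ` Q = {}"
    and Q_inv: "\<And>x y. x \<in> snd ` Q \<Longrightarrow> (x, y) \<in> E \<Longrightarrow> y \<in> snd ` Q"
  obtains S where "S \<in> sets borel" "snd ` P \<subseteq> S" "S \<inter> snd ` Q = {}"
    "E `` S \<subseteq> S"
proof -
  have refl: "(x, x) \<in> E" for x using E(2) by (auto simp: equiv_def refl_on_def)
  define good where "good S \<longleftrightarrow> S \<in> sets borel \<and> snd ` P \<subseteq> S \<and> S \<inter> snd ` Q = {}" for S
  have base: "\<exists>S. good S"
    unfolding good_def using borel_separation_of_projections[OF P Q disj] by metis
  have step: "\<exists>S'. good S' \<and> E `` S \<subseteq> S'" if "good S" for S
  proof -
    have "S \<times> UNIV \<in> sets (borel \<Otimes>\<^sub>M (borel :: 'a measure))" using that by (simp add: good_def)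
    then have ES: "E \<inter> S \<times> UNIV \<in> sets borel" unfolding borel_prod by (rule sets.Int[OF E(1)])
    have img: "snd ` (E \<inter> S \<times> UNIV) = E `` S" by force
    have "snd ` (E \<inter> S \<times> UNIV) \<inter> snd ` Q = {}"
    proof (rule ccontr)
      assume "\<not> ?thesis"
      then obtain x y where "x \<in> S" "(x, y) \<in> E" "y \<in> snd ` Q" unfolding img by blast
      moreover have "(y, x) \<in> E" using \<open>(x, y) \<in> E\<close> E(2) by (meson equiv_def symE)
      ultimately have "x \<in> S \<inter> snd ` Q" using Q_inv by blast
      then show False using that by (auto simp: good_def)
    qed
    then obtain S' where S': "S' \<in> sets borel" "E `` S \<subseteq> S'" "S' \<inter> snd ` Q = {}"
      using borel_separation_of_projections[OF ES Q] unfolding img by blast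
    have "S \<subseteq> E `` S" using refl by blast
    then have "snd ` P \<subseteq> S'" using that S'(2) unfolding good_def by (meson order_trans)
    then have "good S'" unfolding good_def using S' by simp
    then show ?thesis using S'(2) by (intro exI[of _ S'] conjI)
  qed
  have "\<exists>S. \<forall>n::nat. good (S n) \<and> E `` S n \<subseteq> S (Suc n)"
    by (rule dependent_nat_choice) (use base step in auto)
  then obtain S where S: "\<And>n::nat. good (S n)" "\<And>n. E `` S n \<subseteq> S (Suc n)" by blast
  show ?thesis
  proof
    show "(\<Union>n. S n) \<in> sets borel" using S(1) by (auto simp: good_def)
    have "snd ` P \<subseteq> S n" "S n \<inter> snd ` Q = {}" for n using S(1) by (auto simp only: good_def)
    then show "snd ` P \<subseteq> (\<Union>n. S n)" "(\<Union>n. S n) \<inter> snd ` Q = {}" by blast+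
    show "E `` (\<Union>n. S n) \<subseteq> (\<Union>n. S n)" using S(2) by blast
  qed
qed

section \<open>Subcouplings of given mass\<close>

text \<open>Greedy filling: each new cell receives the smaller of the capacities left in its row and
  its column, which saturates one of the two. Later cells only add mass within the capacities, so a
  saturated line stays saturated.\<close>

lemma saturated_transport_plan:
  fixes a :: "'i \<Rightarrow> real" and b :: "'j \<Rightarrow> real"
  assumes "finite I" and a: "\<And>i. 0 \<le> a i" and b: "\<And>j. 0 \<le> b j"
  shows "\<exists>p. (\<forall>z. 0 \<le> p z) \<and>
    (\<forall>i. (\<Sum>z\<in>I. if fst z = i then p z else 0) \<le> a i) \<and>
    (\<forall>j. (\<Sum>z\<in>I. if snd z = j then p z else 0) \<le> b j) \<and>
    (\<forall>i j. (i, j) \<in> I \<longrightarrow> (\<Sum>z\<in>I. if fst z = i then p z else 0) = a i \<or>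
      (\<Sum>z\<in>I. if snd z = j then p z else 0) = b j)"
  using \<open>finite I\<close>
proof induction
  case empty
  then show ?case using a b by (intro exI[of _ "\<lambda>_. 0"]) auto
next
  case (insert w I)
  obtain p where p: "\<And>z. 0 \<le> p z"
    "\<And>i. (\<Sum>z\<in>I. if fst z = i then p z else 0) \<le> a i"
    "\<And>j. (\<Sum>z\<in>I. if snd z = j then p z else 0) \<le> b j"
    "\<And>i j. (i, j) \<in> I \<Longrightarrow> (\<Sum>z\<in>I. if fst z = i then p z else 0) = a i \<or>
      (\<Sum>z\<in>I. if snd z = j then p z else 0) = b j"
    using insert.IH by blast
  define r where "r i = (\<Sum>z\<in>I. if fst z = i then p z else 0)" for i
  define c where "c j = (\<Sum>z\<in>I. if snd z = j then p z else 0)" for j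
  define x where "x = min (a (fst w) - r (fst w)) (b (snd w) - c (snd w))"
  have x: "0 \<le> x" using p(2,3) by (simp add: x_def r_def c_def)
  have sums: "(\<Sum>z\<in>insert w I. if fst z = i then (p(w := x)) z else 0) = r i + (if fst w = i then x else 0)"
    "(\<Sum>z\<in>insert w I. if snd z = j then (p(w := x)) z else 0) = c j + (if snd w = j then x else 0)" for i j
    using insert.hyps unfolding r_def c_def
    by (auto simp: sum.insert intro!: sum.cong)
  show ?case
  proof (intro exI[of _ "p(w := x)"] conjI allI impI, unfold sums)
    show "0 \<le> (p(w := x)) z" for z using x p by simp
    show "r i + (if fst w = i then x else 0) \<le> a i" for i
      using p(2)[of i] by (auto simp: x_def r_def[symmetric])
    show "c j + (if snd w = j then x else 0) \<le> b j" for j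
      using p(3)[of j] by (auto simp: x_def c_def[symmetric])
    fix i j assume ij: "(i, j) \<in> insert w I"
    define z where "z = (i, j)"
    then have z: "z \<in> insert w I" and zf: "fst z = i" "snd z = j" using ij by auto
    have old: "r i = a i \<or> c j = b j" if "z \<in> I"
      using p(4)[of i j] that by (simp add: r_def c_def z_def)
    have le: "r i + (if fst w = i then x else 0) \<le> a i" "c j + (if snd w = j then x else 0) \<le> b j"
      using p(2)[of i] p(3)[of j] by (auto simp: x_def r_def[symmetric] c_def[symmetric])
    have new: "r (fst w) + x = a (fst w) \<or> c (snd w) + x = b (snd w)"
      by (auto simp: x_def min_def)
    show "r i + (if fst w = i then x else 0) = a i \<or> c j + (if snd w = j then x else 0) = b j"
    proof (cases "z = w")
      case True
      then have "fst w = i" "snd w = j" using zf by simp_all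
      with new show ?thesis by simp
    next
      case False
      then have "r i = a i \<or> c j = b j" using old z by simp
      with le x show ?thesis by (auto split: if_splits)
    qed
  qed
qed

text \<open>Every pair of \<open>I\<close> lies in a saturated row or column, so these rows and columns
  form a cover, whose cost is at most twice the transported mass.\<close>
lemma finite_subcoupling:
  fixes q :: "'a \<Rightarrow> 'i" and q' :: "'b \<Rightarrow> 'j"
  assumes M: "finite_measure M" and N: "finite_measure N"
    and q: "\<And>i. q -` {i} \<inter> space M \<in> sets M" and q': "\<And>j. q' -` {j} \<inter> space N \<in> sets N"
    and I: "finite I"
    and G: "G = {(x, y) \<in> space M \<times> space N. (q x, q' y) \<in> I}"
    and t: "\<And>C. C \<in> covers M N G \<Longrightarrow> t \<le> cover_cost M N C"
  obtains \<rho> :: "('a \<times> 'b) set \<Rightarrow> real" where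
    "\<And>S. 0 \<le> \<rho> S" "\<And>S. \<rho> S \<le> \<rho> (space M \<times> space N)"
    "\<And>S T. S \<in> sets (M \<Otimes>\<^sub>M N) \<Longrightarrow> T \<in> sets (M \<Otimes>\<^sub>M N) \<Longrightarrow> S \<inter> T = {} \<Longrightarrow> \<rho> (S \<union> T) = \<rho> S + \<rho> T"
    "\<And>A. A \<in> sets M \<Longrightarrow> \<rho> (A \<times> space N) \<le> measure M A"
    "\<And>D. D \<in> sets N \<Longrightarrow> \<rho> (space M \<times> D) \<le> measure N D"
    "\<And>S. S \<inter> G = {} \<Longrightarrow> \<rho> S = 0"
    "t / 2 \<le> \<rho> (space M \<times> space N)"
proof -
  interpret M: finite_measure M by fact
  interpret N: finite_measure N by fact
  interpret MN: pair_sigma_finite M N ..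
  interpret P: finite_measure "M \<Otimes>\<^sub>M N" by (intro finite_measure_pair_measure M N)
  define X where "X i = q -` {i} \<inter> space M" for i
  define Y where "Y j = q' -` {j} \<inter> space N" for j
  have XY[measurable]: "X i \<in> sets M" "Y j \<in> sets N" for i j using q q' by (auto simp: X_def Y_def)
  define a where "a i = measure M (X i)" for i
  define b where "b j = measure N (Y j)" for j
  obtain p where p: "\<And>z. 0 \<le> p z"
    "\<And>i. (\<Sum>z\<in>I. if fst z = i then p z else 0) \<le> a i"
    "\<And>j. (\<Sum>z\<in>I. if snd z = j then p z else 0) \<le> b j"
    "\<And>i j. (i, j) \<in> I \<Longrightarrow> (\<Sum>z\<in>I. if fst z = i then p z else 0) = a i \<or>
      (\<Sum>z\<in>I. if snd z = j then p z else 0) = b j"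
    using saturated_transport_plan[OF I, of a b] by (simp only: a_def b_def measure_nonneg simp_thms) blast
  define r where "r i = (\<Sum>z\<in>I. if fst z = i then p z else 0)" for i
  define c where "c j = (\<Sum>z\<in>I. if snd z = j then p z else 0)" for j
  have p_r: "p z \<le> r (fst z)" "p z \<le> c (snd z)" if "z \<in> I" for z
    unfolding r_def c_def
    using member_le_sum[OF that _ I, of "\<lambda>u. if fst u = fst z then p u else 0"]
      member_le_sum[OF that _ I, of "\<lambda>u. if snd u = snd z then p u else 0"] p(1) by auto
  \<comment> \<open>A cell of product weight 0 lies in a row or column of capacity 0 and carries no
    mass. The division by \<open>a (fst z) * b (snd z)\<close> below, whose value is then 0,
    therefore loses nothing.\<close>
  have p0: "p z = 0" if "z \<in> I" "a (fst z) * b (snd z) = 0" for z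
    using p_r[OF that(1)] p(1)[of z] p(2)[of "fst z"] p(3)[of "snd z"] that(2)
    by (auto simp: r_def[symmetric] c_def[symmetric])
  \<comment> \<open>Inside each cell the mass is spread like the product measure, so the marginals
    are multiples of \<open>M\<close> and \<open>N\<close> there. As \<open>measure\<close> vanishes
    on nonmeasurable sets, \<open>\<rho>\<close> is a bounded function on all sets, ready for a
    compactness argument over the whole power set.\<close>
  define \<rho> where "\<rho> S = (\<Sum>z\<in>I. p z / (a (fst z) * b (snd z)) *
      measure (M \<Otimes>\<^sub>M N) (S \<inter> X (fst z) \<times> Y (snd z)))" for S
  have w: "0 \<le> p z / (a (fst z) * b (snd z))" for z
    using p(1) by (simp add: a_def b_def)
  have rect: "measure (M \<Otimes>\<^sub>M N) (A \<times> D) = measure M A * measure N D"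
    if "A \<in> sets M" "D \<in> sets N" for A D
    using that by (simp add: measure_def MN.emeasure_pair_measure_Times N.emeasure_pair_measure_Times enn2real_mult)
  have rect_int: "A \<times> D \<inter> X i \<times> Y j = (A \<inter> X i) \<times> (D \<inter> Y j)" for A D i j by auto
  have absorb: "space N \<inter> Y j = Y j" "space M \<inter> X i = X i" for i j
    by (auto simp: X_def Y_def)
  have mass: "\<rho> (space M \<times> space N) = (\<Sum>z\<in>I. p z)"
    unfolding \<rho>_def
  proof (rule sum.cong)
    fix z assume z: "z \<in> I"
    show "p z / (a (fst z) * b (snd z)) *
      measure (M \<Otimes>\<^sub>M N) (space M \<times> space N \<inter> X (fst z) \<times> Y (snd z)) = p z"
      using p0[OF z] by (auto simp: rect_int absorb rect a_def[symmetric] b_def[symmetric])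
  qed simp
  show ?thesis
  proof (rule that[of \<rho>])
    show "0 \<le> \<rho> S" for S unfolding \<rho>_def by (intro sum_nonneg mult_nonneg_nonneg w) auto
    show "\<rho> S \<le> \<rho> (space M \<times> space N)" for S
      unfolding \<rho>_def
    proof (intro sum_mono mult_left_mono w P.finite_measure_mono)
      show "S \<inter> X i \<times> Y j \<subseteq> space M \<times> space N \<inter> X i \<times> Y j" for i j by (auto simp: X_def Y_def)
    qed auto
    show "\<rho> (S \<union> T) = \<rho> S + \<rho> T" if [measurable]: "S \<in> sets (M \<Otimes>\<^sub>M N)" "T \<in> sets (M \<Otimes>\<^sub>M N)"
      and "S \<inter> T = {}" for S T
      unfolding \<rho>_def sum.distrib[symmetric] distrib_left[symmetric] Int_Un_distrib2
      using \<open>S \<inter> T = {}\<close>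
      by (intro sum.cong refl arg_cong2[where f="(*)"] P.finite_measure_Union) auto
    show "\<rho> S = 0" if "S \<inter> G = {}" for S
      unfolding \<rho>_def
    proof (intro sum.neutral ballI)
      fix z assume "z \<in> I"
      then have "S \<inter> X (fst z) \<times> Y (snd z) = {}"
        using that unfolding G by (auto simp: X_def Y_def)
      then show "p z / (a (fst z) * b (snd z)) * measure (M \<Otimes>\<^sub>M N) (S \<inter> X (fst z) \<times> Y (snd z)) = 0"
        by simp
    qed
    show "\<rho> (A \<times> space N) \<le> measure M A" if [measurable]: "A \<in> sets M" for A
    proof -
      have "\<rho> (A \<times> space N) = (\<Sum>z\<in>I. p z / a (fst z) * measure M (A \<inter> X (fst z)))"
        unfolding \<rho>_def
        by (intro sum.cong refl) (use p0 in \<open>auto simp: rect_int absorb rect b_def[symmetric]\<close>)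
      also have "\<dots> = (\<Sum>i\<in>fst ` I. \<Sum>z | z \<in> I \<and> fst z = i. p z / a (fst z) * measure M (A \<inter> X (fst z)))"
        by (rule sum.image_gen[OF I])
      also have "\<dots> = (\<Sum>i\<in>fst ` I. r i / a i * measure M (A \<inter> X i))"
        by (intro sum.cong refl)
           (simp add: r_def sum.inter_filter[OF I, symmetric] sum_distrib_right sum_divide_distrib)
      also have "\<dots> \<le> (\<Sum>i\<in>fst ` I. 1 * measure M (A \<inter> X i))"
        using p(2) by (intro sum_mono mult_right_mono) (auto simp: r_def[symmetric] a_def divide_le_eq_1 less_le)
      also have "\<dots> = measure M (\<Union>i\<in>fst ` I. A \<inter> X i)"
        using I XY that by (subst M.finite_measure_finite_Union) (auto simp: disjoint_family_on_def X_def)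
      also have "\<dots> \<le> measure M A" by (intro M.finite_measure_mono) auto
      finally show ?thesis .
    qed
    show "\<rho> (space M \<times> D) \<le> measure N D" if [measurable]: "D \<in> sets N" for D
    proof -
      have "\<rho> (space M \<times> D) = (\<Sum>z\<in>I. p z / b (snd z) * measure N (D \<inter> Y (snd z)))"
        unfolding \<rho>_def
        by (intro sum.cong refl) (use p0 in \<open>auto simp: rect_int absorb rect a_def[symmetric]\<close>)
      also have "\<dots> = (\<Sum>j\<in>snd ` I. \<Sum>z | z \<in> I \<and> snd z = j. p z / b (snd z) * measure N (D \<inter> Y (snd z)))"
        by (rule sum.image_gen[OF I])
      also have "\<dots> = (\<Sum>j\<in>snd ` I. c j / b j * measure N (D \<inter> Y j))"
        by (intro sum.cong refl)
           (simp add: c_def sum.inter_filter[OF I, symmetric] sum_distrib_right sum_divide_distrib)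
      also have "\<dots> \<le> (\<Sum>j\<in>snd ` I. 1 * measure N (D \<inter> Y j))"
        using p(3) by (intro sum_mono mult_right_mono) (auto simp: c_def[symmetric] b_def divide_le_eq_1 less_le)
      also have "\<dots> = measure N (\<Union>j\<in>snd ` I. D \<inter> Y j)"
        using I XY that by (subst N.finite_measure_finite_Union) (auto simp: disjoint_family_on_def Y_def)
      also have "\<dots> \<le> measure N D" by (intro N.finite_measure_mono) auto
      finally show ?thesis .
    qed
    show "t / 2 \<le> \<rho> (space M \<times> space N)"
    proof -
      define R where "R = {i \<in> fst ` I. r i = a i}"
      define C where "C = {j \<in> snd ` I. c j = b j}"
      have fin: "finite R" "finite C" using I by (auto simp: R_def C_def)
      have "(\<Union>i\<in>R. X i, \<Union>j\<in>C. Y j) \<in> covers M N G"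
        unfolding covers_def
      proof safe
        fix x y assume xy: "(x, y) \<in> G" "y \<notin> (\<Union>j\<in>C. Y j)"
        then have "(q x, q' y) \<in> I" "x \<in> X (q x)" "y \<in> Y (q' y)" by (auto simp: G X_def Y_def)
        moreover from this have "q x \<in> fst ` I" "q' y \<in> snd ` I" by force+
        ultimately show "x \<in> (\<Union>i\<in>R. X i)"
          using p(4)[of "q x" "q' y"] xy(2) unfolding r_def[symmetric] c_def[symmetric] R_def C_def by blast
      qed (use fin in auto)
      from t[OF this] have "t \<le> measure M (\<Union>i\<in>R. X i) + measure N (\<Union>j\<in>C. Y j)"
        by (simp add: cover_cost_def)
      also have "measure M (\<Union>i\<in>R. X i) = (\<Sum>i\<in>R. a i)"
        unfolding a_def using fin XY
        by (subst M.finite_measure_finite_Union) (auto simp: disjoint_family_on_def X_def)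
      also have "measure N (\<Union>j\<in>C. Y j) = (\<Sum>j\<in>C. b j)"
        unfolding b_def using fin XY
        by (subst N.finite_measure_finite_Union) (auto simp: disjoint_family_on_def Y_def)
      also have "(\<Sum>i\<in>R. a i) = (\<Sum>i\<in>R. r i)" by (intro sum.cong) (auto simp: R_def)
      also have "(\<Sum>j\<in>C. b j) = (\<Sum>j\<in>C. c j)" by (intro sum.cong) (auto simp: C_def)
      also have "(\<Sum>i\<in>R. r i) \<le> (\<Sum>z\<in>I. p z)"
        unfolding r_def using p(1) fin
        by (subst sum.swap) (auto intro!: sum_mono simp: sum.delta)
      also have "(\<Sum>j\<in>C. c j) \<le> (\<Sum>z\<in>I. p z)"
        unfolding c_def using p(1) fin
        by (subst sum.swap) (auto intro!: sum_mono simp: sum.delta)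
      finally show ?thesis by (simp add: mass)
    qed
  qed
qed

section \<open>Regularity and extension of finitely additive set functions on rectangles\<close>

lemma inner_approximation:
  fixes M :: "'a::euclidean_space measure"
  assumes M: "finite_measure M" "sets M = sets borel" and B: "B \<in> sets borel" and e: "0 < e"
  obtains K where "compact K" "K \<subseteq> B" "measure M (B - K) < e"
proof -
  interpret finite_measure M by fact
  show ?thesis
  \<comment> \<open>For a null set \<open>measure M B - e\<close> is negative,
    \<open>ennreal\<close> turns it into 0, and the strict inequality used for inner regularity
    would fail.\<close>
  proof (cases "measure M B = 0")
    case True
    then show ?thesis using e by (intro that[of "{}"]) auto
  next
    case False
    then have "0 < measure M B" by (simp add: zero_less_measure_iff)
    then have "ennreal (measure M B - e) < emeasure M B"
      using e by (simp add: emeasure_eq_measure ennreal_lessI)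
    also have "emeasure M B = (SUP K \<in> {K. K \<subseteq> B \<and> compact K}. emeasure M K)"
      by (rule inner_regular) (use M B in auto)
    finally obtain K where K: "K \<subseteq> B" "compact K" "ennreal (measure M B - e) < emeasure M K"
      by (auto simp: less_SUP_iff)
    then have "measure M B - e < measure M K"
      by (metis emeasure_eq_measure ennreal_leI not_less)
    moreover have "K \<in> sets borel" using K(2) by (simp add: borel_compact)
    ultimately have "measure M (B - K) < e"
      using K(1) B M(2) by (subst finite_measure_Diff) auto
    then show ?thesis using K by (intro that)
  qed
qed

lemma outer_approximation:
  fixes M :: "'a::euclidean_space measure"
  assumes M: "finite_measure M" "sets M = sets borel" and B: "B \<in> sets borel" and e: "0 < e"
  obtains U where "open U" "B \<subseteq> U" "measure M (U - B) < e"
proof -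
  obtain K where K: "compact K" "K \<subseteq> - B" "measure M (- B - K) < e"
    using inner_approximation[OF M _ e, of "- B"] B by auto
  moreover have "- B - K = - K - B" by auto
  ultimately show ?thesis using that[of "- K"] compact_imp_closed[OF K(1)] by auto
qed

text \<open>A finitely additive set function is countably additive on rectangles as soon as
  it is dominated by measures on both factors, since these are inner regular for compact sets.\<close>
lemma additive_rectangles_extend:
  fixes M :: "'a::euclidean_space measure" and N :: "'b::euclidean_space measure"
  assumes M: "finite_measure M" "sets M = sets borel"
    and N: "finite_measure N" "sets N = sets borel"
    and nonneg: "\<And>S. 0 \<le> f S"
    and add: "\<And>S T. S \<in> sets borel \<Longrightarrow> T \<in> sets borel \<Longrightarrow> S \<inter> T = {} \<Longrightarrow> f (S \<union> T) = f S + f T"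
    and fM: "\<And>A. A \<in> sets borel \<Longrightarrow> f (A \<times> UNIV) \<le> measure M A"
    and fN: "\<And>D. D \<in> sets borel \<Longrightarrow> f (UNIV \<times> D) \<le> measure N D"
  obtains \<rho> :: "('a \<times> 'b) measure" where "sets \<rho> = sets borel"
    "\<And>A D. A \<in> sets borel \<Longrightarrow> D \<in> sets borel \<Longrightarrow> emeasure \<rho> (A \<times> D) = ennreal (f (A \<times> D))"
proof -
  have f0: "f {} = 0" using add[of "{}" "{}"] by simp
  have rect[intro]: "A \<times> D \<in> sets borel" if "A \<in> sets borel" "D \<in> sets borel"
    for A :: "'a set" and D :: "'b set"
    using that by (simp flip: borel_prod)
  have mono: "f S \<le> f T" if "S \<subseteq> T" "S \<in> sets borel" "T \<in> sets borel" for S T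
    using add[of S "T - S"] that nonneg[of "T - S"] by (simp add: Un_absorb1 sets.Diff)
  have subadd: "f (S \<union> T) \<le> f S + f T" if "S \<in> sets borel" "T \<in> sets borel" for S T
    using add[of S "T - S"] that mono[of "T - S" T] by (simp add: sets.Diff)
  have finsub: "f (\<Union>i\<in>F. S i) \<le> (\<Sum>i\<in>F. f (S i))"
    if "finite F" "\<And>i. S i \<in> sets borel" for F :: "nat set" and S
    using that(1)
  proof induction
    case (insert i F)
    then show ?case using subadd[of "S i" "\<Union>i\<in>F. S i"] that(2) by (simp add: sets.finite_UN)
  qed (simp add: f0)
  have finadd: "f (\<Union>i\<in>F. S i) = (\<Sum>i\<in>F. f (S i))"
    if "finite F" "\<And>i. S i \<in> sets borel" "disjoint_family S" for F :: "nat set" and S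
    using that(1)
  proof induction
    case (insert i F)
    have "S i \<inter> S j = {}" if "j \<in> F" for j
      using disjoint_family_onD[OF \<open>disjoint_family S\<close>, of i j] insert.hyps(2) that by auto
    then have "S i \<inter> (\<Union>i\<in>F. S i) = {}" by auto
    then show ?case using insert add[of "S i" "\<Union>i\<in>F. S i"] that(2) by (simp add: sets.finite_UN)
  qed (simp add: f0)
  \<comment> \<open>Two strips absorb the difference of the rectangles, so the marginal bounds alone
    transfer regularity from \<open>M\<close> and \<open>N\<close> to \<open>f\<close>.\<close>
  have close: "f (A \<times> D) \<le> f (A' \<times> D') + measure M (A - A') + measure N (D - D')"
    if [simp]: "A \<in> sets borel" "D \<in> sets borel" "A' \<in> sets borel" "D' \<in> sets borel" for A D A' D'
  proof -
    have "f (A \<times> D) \<le> f ((A' \<times> D' \<union> (A - A') \<times> UNIV) \<union> UNIV \<times> (D - D'))"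
      by (intro mono) (auto intro!: sets.Un rect sets.Diff)
    also have "\<dots> \<le> f (A' \<times> D' \<union> (A - A') \<times> UNIV) + f (UNIV \<times> (D - D'))"
      by (intro subadd) (auto intro!: sets.Un rect sets.Diff)
    also have "f (A' \<times> D' \<union> (A - A') \<times> UNIV) \<le> f (A' \<times> D') + f ((A - A') \<times> UNIV)"
      by (intro subadd) (auto intro!: rect sets.Diff)
    finally show ?thesis using fM[of "A - A'"] fN[of "D - D'"] by (simp add: sets.Diff)
  qed
  define Rect where "Rect = {A \<times> D | (A :: 'a set) (D :: 'b set). A \<in> sets borel \<and> D \<in> sets borel}"
  have Rect_sets: "R \<in> sets borel" if "R \<in> Rect" for R using that by (auto simp: Rect_def)
  have sigma: "sigma_sets UNIV Rect = sets borel"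
    using sets_pair_measure[of "borel :: 'a measure" "borel :: 'b measure"]
    unfolding borel_prod Rect_def by simp
  interpret semiring_of_sets UNIV Rect
  proof
    show "Rect \<subseteq> Pow UNIV" by simp
    show "{} \<in> Rect" unfolding Rect_def by (auto intro!: exI[of _ "{}"])
    show "a \<inter> b \<in> Rect" if ab: "a \<in> Rect" "b \<in> Rect" for a b
    proof -
      from ab obtain A D A' D' where "a = A \<times> D" "b = A' \<times> D'" and
        [simp]: "A \<in> sets borel" "D \<in> sets borel" "A' \<in> sets borel" "D' \<in> sets borel"
        unfolding Rect_def by blast
      then have "a \<inter> b = (A \<inter> A') \<times> (D \<inter> D')" by auto
      then show ?thesis unfolding Rect_def by (auto intro!: exI[of _ "A \<inter> A'"] exI[of _ "D \<inter> D'"] sets.Int)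
    qed
    show "\<exists>C\<subseteq>Rect. finite C \<and> disjoint C \<and> a - b = \<Union> C" if ab: "a \<in> Rect" "b \<in> Rect" for a b
    proof -
      from ab obtain A D A' D' where *: "a = A \<times> D" "b = A' \<times> D'" and
        [simp]: "A \<in> sets borel" "D \<in> sets borel" "A' \<in> sets borel" "D' \<in> sets borel"
        unfolding Rect_def by blast
      have "a - b = \<Union>{(A - A') \<times> D, (A \<inter> A') \<times> (D - D')}" unfolding * by auto
      moreover have "disjoint {(A - A') \<times> D, (A \<inter> A') \<times> (D - D')}"
        unfolding disjoint_def by auto
      moreover have "(A - A') \<times> D \<in> Rect" "(A \<inter> A') \<times> (D - D') \<in> Rect"
        unfolding Rect_def by (blast intro: sets.Diff sets.Int \<open>A \<in> _\<close> \<open>A' \<in> _\<close> \<open>D \<in> _\<close> \<open>D' \<in> _\<close>)+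
      ultimately show ?thesis by (intro exI[of _ "{(A - A') \<times> D, (A \<inter> A') \<times> (D - D')}"]) auto
    qed
  qed
  have "countably_additive Rect (\<lambda>S. ennreal (f S))"
    unfolding countably_additive_def
  proof (intro allI impI)
    fix R :: "nat \<Rightarrow> ('a \<times> 'b) set"
    assume R: "range R \<subseteq> Rect" "disjoint_family R" "\<Union> (range R) \<in> Rect"
    have Rb: "R i \<in> sets borel" for i using R(1) Rect_sets by blast
    have "\<forall>i. \<exists>A D. R i = A \<times> D \<and> A \<in> sets borel \<and> D \<in> sets borel" using R(1) unfolding Rect_def by blast
    then obtain A D where AD: "\<And>i. R i = A i \<times> D i" "\<And>i. A i \<in> sets borel" "\<And>i. D i \<in> sets borel" by metis
    obtain A' D' where A'D': "\<Union> (range R) = A' \<times> D'" "A' \<in> sets borel" "D' \<in> sets borel"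
      using R(3) unfolding Rect_def by blast
    have part: "(\<Sum>i\<in>F. f (R i)) \<le> f (\<Union> (range R))" if "finite F" for F
      unfolding finadd[OF that Rb R(2), symmetric]
      using that Rb R(3) by (intro mono) (auto simp: Rect_sets intro!: sets.finite_UN)
    then have summ: "summable (\<lambda>i. f (R i))" by (intro summableI_nonneg_bounded nonneg) auto
    have "f (\<Union> (range R)) \<le> (\<Sum>i. f (R i)) + e" if e: "0 < e" for e
    proof -
      \<comment> \<open>The error budget: e/4 for each of the two compact factors inside, and e/4
        for each of the two families of open sets outside, as \<open>d\<close> sums to e/4.\<close>
      define d where "d i = e / 8 * (1/2)^i" for i :: nat
      have d: "0 < d i" for i using e by (simp add: d_def)
      have "d sums (e / 8 * (1 / (1 - 1/2)))"
        unfolding d_def by (intro sums_mult geometric_sums) simp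
      then have d_sums: "d sums (e / 4)" by simp
      obtain K where K: "compact K" "K \<subseteq> A'" "measure M (A' - K) < e / 4"
        using inner_approximation[OF M A'D'(2), of "e/4"] e by auto
      obtain K' where K': "compact K'" "K' \<subseteq> D'" "measure N (D' - K') < e / 4"
        using inner_approximation[OF N A'D'(3), of "e/4"] e by auto
      have "\<forall>i. \<exists>U. open U \<and> A i \<subseteq> U \<and> measure M (U - A i) < d i"
        using outer_approximation[OF M AD(2) d] by metis
      then obtain U where U: "\<And>i. open (U i)" "\<And>i. A i \<subseteq> U i" "\<And>i. measure M (U i - A i) < d i" by metis
      have "\<forall>i. \<exists>V. open V \<and> D i \<subseteq> V \<and> measure N (V - D i) < d i"
        using outer_approximation[OF N AD(3) d] by metis
      then obtain V where V: "\<And>i. open (V i)" "\<And>i. D i \<subseteq> V i" "\<And>i. measure N (V i - D i) < d i" by metis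
      have "K \<times> K' \<subseteq> \<Union> (range R)" using K(2) K'(2) A'D'(1) by auto
      also have "\<dots> \<subseteq> (\<Union>i. U i \<times> V i)" using U(2) V(2) AD(1) by (intro UN_mono) auto
      finally obtain F where F: "finite F" "K \<times> K' \<subseteq> (\<Union>i\<in>F. U i \<times> V i)"
        using compactE_image[OF compact_Times[OF K(1) K'(1)], of UNIV "\<lambda>i. U i \<times> V i"]
          open_Times[OF U(1) V(1)] by auto
      have UV: "U i \<in> sets borel" "V i \<in> sets borel" for i using U(1) V(1) by auto
      have KK: "K \<in> sets borel" "K' \<in> sets borel" using K(1) K'(1) by (auto simp: borel_compact)
      have "f (\<Union> (range R)) \<le> f (K \<times> K') + e / 4 + e / 4"
        using close[OF A'D'(2,3) KK] K(3) K'(3) by (simp add: A'D'(1))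
      also have "f (K \<times> K') \<le> f (\<Union>i\<in>F. U i \<times> V i)"
        using F UV KK by (intro mono) (auto intro!: sets.finite_UN)
      also have "\<dots> \<le> (\<Sum>i\<in>F. f (U i \<times> V i))" using F UV by (intro finsub) auto
      also have "\<dots> \<le> (\<Sum>i\<in>F. f (R i) + (d i + d i))"
        using close[OF UV AD(2,3)] U(3) V(3) by (intro sum_mono) (smt (verit) AD(1))
      also have "\<dots> \<le> (\<Sum>i. f (R i) + (d i + d i))"
        using F(1) nonneg d d_sums
        by (intro sum_le_suminf summable_add summ sums_summable[OF d_sums]) (auto simp: less_imp_le add_nonneg_nonneg)
      also have "\<dots> = (\<Sum>i. f (R i)) + (e / 4 + e / 4)"
        using sums_add[OF summable_sums[OF summ] sums_add[OF d_sums d_sums]] by (rule sums_unique[symmetric])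
      finally show ?thesis by simp
    qed
    then have "f (\<Union> (range R)) \<le> (\<Sum>i. f (R i))" by (rule field_le_epsilon)
    moreover have "(\<Sum>i. f (R i)) \<le> f (\<Union> (range R))"
      by (intro suminf_le_const summ part) auto
    ultimately have "(\<Sum>i. f (R i)) = f (\<Union> (range R))" by simp
    then show "(\<Sum>i. ennreal (f (R i))) = ennreal (f (\<Union> (range R)))"
      using suminf_ennreal2[OF nonneg summ] by simp
  qed
  then obtain \<mu> where \<mu>: "\<forall>S\<in>Rect. \<mu> S = ennreal (f S)" "measure_space UNIV (sigma_sets UNIV Rect) \<mu>"
    using caratheodory[of "\<lambda>S. ennreal (f S)"] by (auto simp: positive_def f0)
  show ?thesis
  proof (rule that[of "measure_of UNIV Rect \<mu>"])
    show "sets (measure_of UNIV Rect \<mu>) = sets borel" using sigma by (simp add: sets_measure_of)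
    fix A :: "'a set" and D :: "'b set" assume "A \<in> sets borel" "D \<in> sets borel"
    then have AD: "A \<times> D \<in> Rect" by (auto simp: Rect_def)
    have "emeasure (measure_of UNIV Rect \<mu>) (A \<times> D) = \<mu> (A \<times> D)"
      using \<mu>(2) AD by (intro emeasure_measure_of[OF refl]) (auto simp: measure_space_def sets_measure_of)
    then show "emeasure (measure_of UNIV Rect \<mu>) (A \<times> D) = ennreal (f (A \<times> D))"
      using \<mu>(1) AD by simp
  qed
qed

section \<open>Dyadic grids and setwise limits of transport plans\<close>

definition dyadic :: "nat \<Rightarrow> real \<Rightarrow> int" where
  "dyadic n x = \<lfloor>2 ^ n * x\<rfloor>"

text \<open>The grids are nested, so that the grid neighbourhoods of a decreasing sequence of sets,
  taken on finer and finer grids, decrease as well.\<close>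

lemma dyadic_Suc: "dyadic n x = dyadic (Suc n) x div 2"
proof -
  have "\<lfloor>2 ^ Suc n * x / real_of_int 2\<rfloor> = \<lfloor>2 ^ Suc n * x\<rfloor> div 2"
    by (rule floor_divide_real_eq_div) simp
  then show ?thesis by (simp add: dyadic_def)
qed

lemma dyadic_measurable: "dyadic n -` {i} \<in> sets borel"
proof -
  have "(\<lambda>x::real. \<lfloor>2 ^ n * x\<rfloor>) \<in> borel \<rightarrow>\<^sub>M count_space (UNIV :: int set)" by measurable
  from measurable_sets[OF this, of "{i}"] show ?thesis by (simp add: dyadic_def vimage_def)
qed

lemma dyadic_eq_dist: "dyadic n x = dyadic n y \<Longrightarrow> dist x y \<le> (1/2) ^ n"
proof -
  assume "dyadic n x = dyadic n y"
  then have "\<bar>2 ^ n * x - 2 ^ n * y\<bar> \<le> 1" unfolding dyadic_def by linarith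
  then have "2 ^ n * \<bar>x - y\<bar> \<le> 1" by (simp add: abs_mult flip: right_diff_distrib)
  then show ?thesis by (simp add: dist_real_def field_simps power_divide)
qed

lemma finite_dyadic_image:
  assumes "bounded K"
  shows "finite ((\<lambda>(x, y). (dyadic n x, dyadic n y)) ` K)"
proof -
  obtain b where b: "\<And>z. z \<in> K \<Longrightarrow> norm z \<le> b" using assms by (auto simp: bounded_iff)
  have "(\<lambda>(x, y). (dyadic n x, dyadic n y)) ` K \<subseteq>
      {\<lfloor>2 ^ n * - b\<rfloor>..\<lfloor>2 ^ n * b\<rfloor>} \<times> {\<lfloor>2 ^ n * - b\<rfloor>..\<lfloor>2 ^ n * b\<rfloor>}"
  proof clarify
    fix x y assume "(x, y) \<in> K"
    then have "\<bar>x\<bar> \<le> b" "\<bar>y\<bar> \<le> b"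
      using b[of "(x, y)"] norm_fst_le[of x y] norm_snd_le[of y x] by (auto intro: order_trans)
    then have "2 ^ n * - b \<le> 2 ^ n * x" "2 ^ n * x \<le> 2 ^ n * b" "2 ^ n * - b \<le> 2 ^ n * y" "2 ^ n * y \<le> 2 ^ n * b"
      by (intro mult_left_mono; simp add: abs_le_iff)+
    then show "dyadic n x \<in> {\<lfloor>2 ^ n * - b\<rfloor>..\<lfloor>2 ^ n * b\<rfloor>} \<and>
        dyadic n y \<in> {\<lfloor>2 ^ n * - b\<rfloor>..\<lfloor>2 ^ n * b\<rfloor>}"
      unfolding dyadic_def atLeastAtMost_iff by (intro conjI floor_mono)
  qed
  then show ?thesis by (rule finite_subset) simp
qed

text \<open>The index type will be the power set of the plane, where Tychonoff's theorem gives a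
  cluster point but no convergent subsequence. The conclusion keeps what is needed of a limit: every
  closed condition that holds from some index on is inherited by \<open>f\<close>.\<close>

lemma cluster_function:
  fixes \<rho> :: "nat \<Rightarrow> 'a \<Rightarrow> real"
  assumes "\<And>n x. \<rho> n x \<in> {0..b}"
  obtains f where "\<And>D k. closed D \<Longrightarrow> (\<And>n. k \<le> n \<Longrightarrow> \<rho> n \<in> D) \<Longrightarrow> f \<in> D"
proof -
  have "compact (PiE UNIV (\<lambda>_::'a. {0..b}))"
    using compactin_PiE[of "\<lambda>_. euclidean :: real topology" UNIV "\<lambda>_::'a. {0..b}"]
    by (simp add: euclidean_product_topology)
  moreover have "filtermap \<rho> sequentially \<noteq> bot" by (simp add: filtermap_bot_iff)
  moreover have "eventually (\<lambda>f. f \<in> PiE UNIV (\<lambda>_. {0..b})) (filtermap \<rho> sequentially)"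
    using assms by (simp add: eventually_filtermap PiE_def)
  ultimately obtain f where f: "inf (nhds f) (filtermap \<rho> sequentially) \<noteq> bot"
    unfolding compact_filter by blast
  show ?thesis
  proof (rule that[of f], rule ccontr)
    fix D k assume D: "closed D" "\<And>n. k \<le> n \<Longrightarrow> \<rho> n \<in> D" "f \<notin> D"
    then have "eventually (\<lambda>g. g \<in> - D) (nhds f)" by (intro eventually_nhds_in_open) auto
    moreover have "eventually (\<lambda>g. g \<in> D) (filtermap \<rho> sequentially)"
      using D(2) unfolding eventually_filtermap eventually_sequentially by blast
    ultimately have "eventually (\<lambda>_. False) (inf (nhds f) (filtermap \<rho> sequentially))"
      unfolding eventually_inf by blast
    with f show False by (simp add: trivial_limit_def)
  qed
qed

lemma borel_subcoupling:
  fixes M N :: "real measure"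
  assumes M: "finite_measure M" "sets M = sets borel"
    and N: "finite_measure N" "sets N = sets borel"
    and L: "L \<in> sets borel"
    and t: "\<And>C. C \<in> covers M N L \<Longrightarrow> t < cover_cost M N C"
  obtains \<rho> :: "(real \<times> real) measure" where "sets \<rho> = sets borel"
    "\<And>A. A \<in> sets borel \<Longrightarrow> emeasure \<rho> (A \<times> UNIV) \<le> emeasure M A"
    "\<And>D. D \<in> sets borel \<Longrightarrow> emeasure \<rho> (UNIV \<times> D) \<le> emeasure N D"
    "emeasure \<rho> (- L) = 0" "ennreal (t / 2) \<le> emeasure \<rho> UNIV"
proof -
  interpret M: finite_measure M by fact
  interpret N: finite_measure N by fact
  have sp: "space M = UNIV" "space N = UNIV" using M(2) N(2) by (auto dest: sets_eq_imp_space_eq)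
  have MN_sets: "sets (M \<Otimes>\<^sub>M N) = sets borel"
    using sets_pair_measure_cong[OF M(2) N(2)] unfolding borel_prod .
  obtain K where K: "\<And>n::nat. compact (K n)" "decseq K"
    "\<And>n C. C \<in> covers M N (K n) \<Longrightarrow> t < cover_cost M N C" "(\<Inter>n. K n) \<subseteq> L"
  \<comment> \<open>The bound is strict because its negation, a cover of cost at most
    \<open>t\<close> for every \<open>A n\<close>, passes to the union without loss by
    \<open>cover_cost_continuous\<close>.\<close>
  proof (rule choquet_capacitability[of L "\<lambda>Z. \<forall>C \<in> covers M N Z. t < cover_cost M N C", OF L])
    show "\<forall>C \<in> covers M N L. t < cover_cost M N C" using t by blast
    show "\<forall>C \<in> covers M N B. t < cover_cost M N C"
      if "\<forall>C \<in> covers M N A. t < cover_cost M N C" "A \<subseteq> B" for A B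
    proof -
      have "covers M N B \<subseteq> covers M N A" using \<open>A \<subseteq> B\<close> by (auto simp: covers_def)
      then show ?thesis using that(1) by blast
    qed
    show "\<exists>n. \<forall>C \<in> covers M N (A n). t < cover_cost M N C"
      if "incseq A" "\<forall>C \<in> covers M N (\<Union>n::nat. A n). t < cover_cost M N C" for A
    proof (rule ccontr)
      assume "\<nexists>n. \<forall>C \<in> covers M N (A n). t < cover_cost M N C"
      then have "\<exists>C \<in> covers M N (A n). cover_cost M N C \<le> t" for n by (auto simp: not_less)
      from cover_cost_continuous[OF M(1) N(1) that(1) this] that(2) show False by force
    qed
  qed blast
  define I where "I n = (\<lambda>(x, y). (dyadic n x, dyadic n y)) ` K n" for n
  \<comment> \<open>A plan on the grid spreads its mass over whole cells. It is carried by the union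
    \<open>G n\<close> of the cells that meet \<open>K n\<close>, not by \<open>K n\<close>
    itself.\<close>
  define G where "G n = {(x, y) \<in> space M \<times> space N. (dyadic n x, dyadic n y) \<in> I n}" for n
  have KG: "K n \<subseteq> G n" for n by (auto simp: G_def I_def sp)
  have "\<exists>\<rho> :: (real \<times> real) set \<Rightarrow> real. (\<forall>S. 0 \<le> \<rho> S) \<and> (\<forall>S. \<rho> S \<le> \<rho> UNIV) \<and>
    (\<forall>S T. S \<in> sets borel \<longrightarrow> T \<in> sets borel \<longrightarrow> S \<inter> T = {} \<longrightarrow> \<rho> (S \<union> T) = \<rho> S + \<rho> T) \<and>
    (\<forall>A. A \<in> sets borel \<longrightarrow> \<rho> (A \<times> UNIV) \<le> measure M A) \<and>
    (\<forall>D. D \<in> sets borel \<longrightarrow> \<rho> (UNIV \<times> D) \<le> measure N D) \<and>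
    (\<forall>S. S \<inter> G n = {} \<longrightarrow> \<rho> S = 0) \<and> t / 2 \<le> \<rho> UNIV" for n
  proof -
    have I: "finite (I n)" unfolding I_def by (intro finite_dyadic_image compact_imp_bounded K)
    have cost: "t \<le> cover_cost M N C" if "C \<in> covers M N (G n)" for C
    proof -
      have "C \<in> covers M N (K n)" using that KG[of n] by (auto simp: covers_def)
      then show ?thesis using K(3) by (simp add: less_imp_le)
    qed
    have cells: "dyadic n -` {i} \<inter> space M \<in> sets M" "dyadic n -` {i} \<inter> space N \<in> sets N" for i
      using dyadic_measurable[of n i] by (auto simp: M(2) N(2) sp)
    show ?thesis
      by (rule finite_subcoupling[OF M(1) N(1) cells I G_def cost,
          unfolded MN_sets sp M(2) N(2) UNIV_Times_UNIV]) blast+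
  qed
  then obtain r where r: "\<And>n S. 0 \<le> r n S" "\<And>n S. r n S \<le> r n UNIV"
    "\<And>n S T. S \<in> sets borel \<Longrightarrow> T \<in> sets borel \<Longrightarrow> S \<inter> T = {} \<Longrightarrow> r n (S \<union> T) = r n S + r n T"
    "\<And>n A. A \<in> sets borel \<Longrightarrow> r n (A \<times> UNIV) \<le> measure M A"
    "\<And>n D. D \<in> sets borel \<Longrightarrow> r n (UNIV \<times> D) \<le> measure N D"
    "\<And>n S. S \<inter> G n = {} \<Longrightarrow> r n S = 0" "\<And>n. t / 2 \<le> r n UNIV"
    by metis
  have r_bounds: "r n S \<in> {0..measure M UNIV}" for n S
    using r(1)[of n S] r(2)[of n S] r(4)[of UNIV n] by auto
  then obtain f where f: "\<And>D k. closed D \<Longrightarrow> (\<And>n. k \<le> n \<Longrightarrow> r n \<in> D) \<Longrightarrow> f \<in> D"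
    using cluster_function[of r "measure M UNIV", OF r_bounds] by blast
  \<comment> \<open>Evaluation at a set is continuous in the product topology, so each equation or
    weak inequality between finitely many values is a closed condition and passes to
    \<open>f\<close>.\<close>
  note coord = continuous_on_product_coordinates
  have f_nonneg: "0 \<le> f S" for S
    using f[of "{g. 0 \<le> g S}" 0] r(1) by (simp add: closed_Collect_le coord)
  have f_add: "f (S \<union> T) = f S + f T" if "S \<in> sets borel" "T \<in> sets borel" "S \<inter> T = {}" for S T
    using f[of "{g. g (S \<union> T) = g S + g T}" 0] r(3) that
    by (simp add: closed_Collect_eq continuous_on_add coord)
  have fM: "f (A \<times> UNIV) \<le> measure M A" if "A \<in> sets borel" for A
    using f[of "{g. g (A \<times> UNIV) \<le> measure M A}" 0] r(4) that by (simp add: closed_Collect_le coord)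
  have fN: "f (UNIV \<times> D) \<le> measure N D" if "D \<in> sets borel" for D
    using f[of "{g. g (UNIV \<times> D) \<le> measure N D}" 0] r(5) that by (simp add: closed_Collect_le coord)
  have "closed {g :: (real \<times> real) set \<Rightarrow> real. t / 2 \<le> g UNIV}"
    by (intro closed_Collect_le continuous_on_const coord)
  then have f_mass: "t / 2 \<le> f UNIV" using f[of _ 0] r(7) by blast
  have G_dec: "G n \<subseteq> G k" if "k \<le> n" for k n
  proof -
    have "G (Suc n) \<subseteq> G n" for n
    proof clarify
      fix x y assume "(x, y) \<in> G (Suc n)"
      then obtain x' y' where "(x', y') \<in> K (Suc n)" "dyadic (Suc n) x = dyadic (Suc n) x'"
        "dyadic (Suc n) y = dyadic (Suc n) y'" by (auto simp: G_def I_def)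
      then have "(x', y') \<in> K n" "dyadic n x = dyadic n x'" "dyadic n y = dyadic n y'"
        using decseqD[OF K(2), of n "Suc n"] by (auto simp: dyadic_Suc[of n])
      then show "(x, y) \<in> G n" by (force simp: G_def I_def sp)
    qed
    then show ?thesis using that by (rule lift_Suc_antimono_le)
  qed
  have f_G: "f S = 0" if "S \<inter> G k = {}" for S k
    using f[of "{g. g S = 0}" k] r(6)[of S] G_dec[of k] that by (simp add: closed_Collect_eq coord) blast
  obtain \<rho> where \<rho>: "sets \<rho> = sets borel"
    "\<And>A D. A \<in> sets borel \<Longrightarrow> D \<in> sets borel \<Longrightarrow> emeasure \<rho> (A \<times> D) = ennreal (f (A \<times> D))"
    using additive_rectangles_extend[OF M N f_nonneg f_add fM fN] by blast
  \<comment> \<open>\<open>\<rho>\<close> is known to agree with \<open>f\<close> on rectangles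
    only. The vanishing of \<open>f\<close> off \<open>G k\<close> is therefore applied to each of
    the countably many cells outside \<open>I k\<close>.\<close>
  have null: "- G k \<in> null_sets \<rho>" for k
  proof -
    have "(\<Union>(i, j)\<in>- I k. dyadic k -` {i} \<times> dyadic k -` {j}) \<in> null_sets \<rho>"
    proof (rule null_sets_UN')
      fix z assume "z \<in> - I k"
      then have "dyadic k -` {fst z} \<times> dyadic k -` {snd z} \<inter> G k = {}" by (auto simp: G_def)
      then have "emeasure \<rho> (dyadic k -` {fst z} \<times> dyadic k -` {snd z}) = 0"
        using f_G by (subst \<rho>(2)) (auto intro: dyadic_measurable)
      moreover have "dyadic k -` {fst z} \<times> dyadic k -` {snd z} \<in> sets \<rho>"
        using dyadic_measurable pair_measureI[of _ "borel :: real measure" _ "borel :: real measure"]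
        unfolding \<rho>(1) borel_prod by blast
      ultimately show "(case z of (i, j) \<Rightarrow> dyadic k -` {i} \<times> dyadic k -` {j}) \<in> null_sets \<rho>"
        by (auto simp: case_prod_unfold)
    qed simp
    moreover have "(\<Union>(i, j)\<in>- I k. dyadic k -` {i} \<times> dyadic k -` {j}) = - G k"
      by (auto simp: G_def sp)
    ultimately show ?thesis by simp
  qed
  \<comment> \<open>A point of every \<open>G n\<close> shares its cell with some point of
    \<open>K n\<close>. Cell sizes tend to 0, so these points converge to it, and each closed
    \<open>K m\<close> contains the limit.\<close>
  have "(\<Inter>k. G k) \<subseteq> L"
  proof clarify
    fix x y assume xy: "(x, y) \<in> (\<Inter>k. G k)"
    have "(x, y) \<in> K m" for m
    proof -
      have "\<exists>z. z \<in> K n \<and> dist (fst z) x \<le> (1/2) ^ n \<and> dist (snd z) y \<le> (1/2) ^ n" for n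
      proof -
        have "(x, y) \<in> G n" using xy by blast
        then obtain x' y' where "(x', y') \<in> K n" "dyadic n x = dyadic n x'" "dyadic n y = dyadic n y'"
          by (auto simp: G_def I_def)
        then show ?thesis by (intro exI[of _ "(x', y')"]) (auto intro: dyadic_eq_dist)
      qed
      then obtain z where z: "\<And>n. z n \<in> K n" "\<And>n. dist (fst (z n)) x \<le> (1/2) ^ n"
        "\<And>n. dist (snd (z n)) y \<le> (1/2) ^ n" by metis
      have zK: "z (n + m) \<in> K m" for n using z(1) decseqD[OF K(2), of m "n + m"] by auto
      have half: "(\<lambda>n. (1/2) ^ n :: real) \<longlonglongrightarrow> 0" by (intro LIMSEQ_power_zero) auto
      have "(\<lambda>n. fst (z n)) \<longlonglongrightarrow> x" "(\<lambda>n. snd (z n)) \<longlonglongrightarrow> y"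
        unfolding tendsto_dist_iff[of _ x] tendsto_dist_iff[of _ y]
        by (rule tendsto_sandwich[OF _ _ tendsto_const half]; use z in auto)+
      then have "(\<lambda>n. (fst (z n), snd (z n))) \<longlonglongrightarrow> (x, y)" by (rule tendsto_Pair)
      then have "(\<lambda>n. z (n + m)) \<longlonglongrightarrow> (x, y)" by (auto intro: LIMSEQ_ignore_initial_segment)
      then show ?thesis by (rule closed_sequentially[OF compact_imp_closed[OF K(1)] zK])
    qed
    then show "(x, y) \<in> L" using K(4) by blast
  qed
  then have "- L \<subseteq> (\<Union>k. - G k)" by blast
  moreover have "(\<Union>k. - G k) \<in> null_sets \<rho>" using null by (intro null_sets_UN) auto
  moreover have "- L \<in> sets \<rho>" using L \<rho>(1) by auto
  ultimately have L_null: "emeasure \<rho> (- L) = 0" by (meson null_sets_subset null_setsD1)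
  show ?thesis
  proof (rule that[of \<rho>])
    show "emeasure \<rho> (A \<times> UNIV) \<le> emeasure M A" if "A \<in> sets borel" for A
      using fM that by (simp add: \<rho>(2) M.emeasure_eq_measure ennreal_leI)
    show "emeasure \<rho> (UNIV \<times> D) \<le> emeasure N D" if "D \<in> sets borel" for D
      using fN that by (simp add: \<rho>(2) N.emeasure_eq_measure ennreal_leI)
    show "ennreal (t / 2) \<le> emeasure \<rho> UNIV"
      using f_mass \<rho>(2)[of UNIV UNIV] by (simp add: ennreal_leI)
  qed (use \<rho>(1) L_null in auto)
qed

section \<open>Couplings on an equivalence relation\<close>

lemma measure_series:
  fixes \<rho> :: "nat \<Rightarrow> 'a measure"
  assumes "\<And>n. sets (\<rho> n) = sets M"
  obtains Q where "sets Q = sets M" "\<And>A. A \<in> sets M \<Longrightarrow> emeasure Q A = (\<Sum>n. emeasure (\<rho> n) A)"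
proof -
  define Q where "Q = measure_of (space M) (sets M) (\<lambda>A. \<Sum>n. emeasure (\<rho> n) A)"
  have "countably_additive (sets M) (\<lambda>A. \<Sum>n. emeasure (\<rho> n) A)"
    unfolding countably_additive_def
  proof (intro allI impI)
    fix A :: "nat \<Rightarrow> 'a set" assume A: "range A \<subseteq> sets M" "disjoint_family A"
    have "(\<Sum>i. \<Sum>n. emeasure (\<rho> n) (A i)) = (\<Sum>i. \<integral>\<^sup>+n. emeasure (\<rho> n) (A i) \<partial>count_space UNIV)"
      by (simp add: nn_integral_count_space_nat)
    also have "\<dots> = (\<integral>\<^sup>+n. (\<Sum>i. emeasure (\<rho> n) (A i)) \<partial>count_space UNIV)"
      by (rule nn_integral_suminf[symmetric]) simp
    also have "\<dots> = (\<Sum>n. \<Sum>i. emeasure (\<rho> n) (A i))"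
      by (simp add: nn_integral_count_space_nat)
    also have "\<dots> = (\<Sum>n. emeasure (\<rho> n) (\<Union>i. A i))"
      using A assms by (intro suminf_cong suminf_emeasure) auto
    finally show "(\<Sum>i. \<Sum>n. emeasure (\<rho> n) (A i)) = (\<Sum>n. emeasure (\<rho> n) (\<Union>i. A i))" .
  qed
  then have "emeasure Q A = (\<Sum>n. emeasure (\<rho> n) A)" if "A \<in> sets M" for A
    unfolding Q_def using that
    by (intro emeasure_measure_of_sigma sets.sigma_algebra_axioms) (auto simp: positive_def)
  moreover have "sets Q = sets M" by (simp add: Q_def)
  ultimately show ?thesis using that by blast
qed

text \<open>In the application \<open>E\<close> is the kernel of a generating plot and
  \<open>\<phi>\<close>, \<open>\<psi>\<close> represent the two random variables on the line, so
  \<open>L\<close> is the event that their values in \<open>V\<close> coincide.\<close>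

locale fibre_product =
  fixes E :: "(real \<times> real) set" and \<phi> \<psi> :: "real \<Rightarrow> real"
  assumes E: "E \<in> sets borel" "equiv UNIV E"
    and \<phi>: "\<phi> \<in> borel_measurable borel" and \<psi>: "\<psi> \<in> borel_measurable borel"
begin

definition L :: "(real \<times> real) set" where
  "L = {(x, y). (\<phi> x, \<psi> y) \<in> E}"

definition balanced :: "real measure \<Rightarrow> real measure \<Rightarrow> bool" where
  "balanced M N \<longleftrightarrow> finite_measure M \<and> sets M = sets borel \<and> finite_measure N \<and> sets N = sets borel \<and>
    (\<forall>S \<in> sets borel. E `` S \<subseteq> S \<longrightarrow>
      measure M (\<phi> -` S) = measure N (\<psi> -` S))"

lemma pullback_measurable:
  assumes [measurable]: "f \<in> borel_measurable borel" "g \<in> borel_measurable borel"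
  shows "{(x, y). (f x, g y) \<in> E} \<in> sets (borel :: (real \<times> real) measure)"
proof -
  have E': "E \<in> sets (borel \<Otimes>\<^sub>M borel)" using E(1) unfolding borel_prod .
  have "(\<lambda>z. (f (fst z), g (snd z))) \<in> (borel \<Otimes>\<^sub>M borel) \<rightarrow>\<^sub>M (borel \<Otimes>\<^sub>M borel)" by measurable
  from measurable_sets[OF this E'] show ?thesis
    unfolding borel_prod by (simp add: vimage_def case_prod_unfold)
qed

lemma L_borel: "L \<in> sets borel"
  unfolding L_def by (rule pullback_measurable[OF \<phi> \<psi>])

text \<open>If \<open>(A, D)\<close> covers \<open>L\<close>, the saturations of the images of the complements of \<open>A\<close> and \<open>D\<close>
  are disjoint, so an invariant Borel set separates them.\<close>
lemma balanced_cover_cost: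
  assumes bal: "balanced M N" and C: "C \<in> covers M N L"
  shows "measure M UNIV \<le> cover_cost M N C"
proof -
  obtain A D where AD: "C = (A, D)" by (cases C)
  interpret M: finite_measure M using bal by (simp add: balanced_def)
  interpret N: finite_measure N using bal by (simp add: balanced_def)
  have s: "sets M = sets borel" "sets N = sets borel" using bal by (auto simp: balanced_def)
  have A: "A \<in> sets borel" and D: "D \<in> sets borel"
    and cov: "\<And>x y. (\<phi> x, \<psi> y) \<in> E \<Longrightarrow> x \<in> A \<or> y \<in> D"
    using C s unfolding AD covers_def L_def by auto
  have refl: "(x, x) \<in> E" and sym: "(x, y) \<in> E \<Longrightarrow> (y, x) \<in> E"
    and trans: "(x, y) \<in> E \<Longrightarrow> (y, z) \<in> E \<Longrightarrow> (x, z) \<in> E" for x y z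
    using E(2) by (auto simp: equiv_def refl_on_def dest: symD transD)
  \<comment> \<open>The projection of \<open>P\<close> is the saturation of the image of
    \<open>- A\<close> under \<open>\<phi>\<close>. It is in general only analytic, hence kept as
    the projection of a Borel set; \<open>Q\<close> does the same for \<open>- D\<close> and
    \<open>\<psi>\<close>.\<close>
  define P where "P = {(x, z). (\<phi> x, z) \<in> E} \<inter> (- A) \<times> UNIV"
  define Q where "Q = {(y, z). (\<psi> y, z) \<in> E} \<inter> (- D) \<times> UNIV"
  have "(- A) \<times> UNIV \<in> sets (borel :: (real \<times> real) measure)" "(- D) \<times> UNIV \<in> sets (borel :: (real \<times> real) measure)"
    using A D unfolding borel_prod[symmetric] by auto
  then have PQ: "P \<in> sets borel" "Q \<in> sets borel"
    unfolding P_def Q_def using pullback_measurable[OF \<phi>, of "\<lambda>z. z"] pullback_measurable[OF \<psi>, of "\<lambda>z. z"]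
    by auto
  have disj: "snd ` P \<inter> snd ` Q = {}"
  proof (rule ccontr)
    assume "snd ` P \<inter> snd ` Q \<noteq> {}"
    then obtain x y z where "x \<notin> A" "y \<notin> D" "(\<phi> x, z) \<in> E" "(\<psi> y, z) \<in> E"
      unfolding P_def Q_def by auto
    then show False using cov[of x y] trans[OF _ sym] by blast
  qed
  have inv: "z' \<in> snd ` Q" if "z \<in> snd ` Q" "(z, z') \<in> E" for z z'
  proof -
    from that(1) obtain y where "y \<notin> D" "(\<psi> y, z) \<in> E" unfolding Q_def by auto
    then have "(y, z') \<in> Q" using trans[OF _ that(2)] by (simp add: Q_def)
    then show ?thesis by force
  qed
  obtain S where S: "S \<in> sets borel" "snd ` P \<subseteq> S" "S \<inter> snd ` Q = {}"
    "E `` S \<subseteq> S"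
    by (rule invariant_borel_separation[OF E PQ disj]) (erule (1) inv, rule that)
  have meas: "\<phi> -` S \<in> sets borel" "\<psi> -` S \<in> sets borel"
    using measurable_sets[OF \<phi> S(1)] measurable_sets[OF \<psi> S(1)] by auto
  have "- A \<subseteq> \<phi> -` S"
  proof
    fix x assume "x \<in> - A"
    then have "(x, \<phi> x) \<in> P" using refl by (simp add: P_def)
    then show "x \<in> \<phi> -` S" using S(2) by force
  qed
  then have "measure M (- A) \<le> measure M (\<phi> -` S)"
    using meas s by (intro M.finite_measure_mono) auto
  also have "\<dots> = measure N (\<psi> -` S)" using bal S(1,4) unfolding balanced_def by blast
  also have "\<dots> \<le> measure N D"
  proof (rule N.finite_measure_mono)
    show "\<psi> -` S \<subseteq> D"
    proof (rule ccontr)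
      assume "\<not> ?thesis"
      then obtain y where y: "\<psi> y \<in> S" "y \<notin> D" by auto
      then have "(y, \<psi> y) \<in> Q" using refl by (simp add: Q_def)
      then have "\<psi> y \<in> snd ` Q" by force
      with S(3) y(1) show False by blast
    qed
  qed (use D s in auto)
  finally have "measure M (- A) \<le> measure N D" .
  moreover have "measure M UNIV = measure M A + measure M (- A)"
  proof -
    have "measure M (A \<union> - A) = measure M A + measure M (- A)"
      using A s by (intro M.finite_measure_Union) auto
    then show ?thesis by simp
  qed
  ultimately show ?thesis by (simp add: AD cover_cost_def)
qed

lemma balanced_split:
  assumes bal: "balanced M N"
  shows "\<exists>M' N' \<rho>. balanced M' N' \<and> finite_measure \<rho> \<and> sets \<rho> = sets borel \<and> emeasure \<rho> (- L) = 0 \<and>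
    (\<forall>A \<in> sets borel. measure M A = measure M' A + measure \<rho> (A \<times> UNIV)) \<and>
    (\<forall>D \<in> sets borel. measure N D = measure N' D + measure \<rho> (UNIV \<times> D)) \<and>
    measure M' UNIV \<le> 2/3 * measure M UNIV"
proof (cases "measure M UNIV = 0")
  case True
  have "finite_measure (null_measure (borel :: (real \<times> real) measure))"
    by (rule finite_measureI) simp
  then show ?thesis
    using bal True by (intro exI[of _ M] exI[of _ N] exI[of _ "null_measure borel"]) (simp add: measure_def)
next
  case False
  interpret M: finite_measure M using bal by (simp add: balanced_def)
  interpret N: finite_measure N using bal by (simp add: balanced_def)
  have s: "sets M = sets borel" "sets N = sets borel" using bal by (auto simp: balanced_def)
  have sp: "space M = UNIV" "space N = UNIV" using s by (auto dest: sets_eq_imp_space_eq)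
  have "0 < measure M UNIV" using False by (simp add: zero_less_measure_iff)
  \<comment> \<open>\<open>borel_subcoupling\<close> asks for a strict bound. Covers cost at least
    the full mass, which is positive here, so any fraction of it below 1 would do; with 2/3 the
    subcoupling takes at least 1/3 of the mass and leaves at most 2/3.\<close>
  then have "2/3 * measure M UNIV < cover_cost M N C" if "C \<in> covers M N L" for C
    using balanced_cover_cost[OF bal that] by simp
  then obtain \<rho> where \<rho>: "sets \<rho> = sets (borel :: (real \<times> real) measure)"
    "\<And>A. A \<in> sets borel \<Longrightarrow> emeasure \<rho> (A \<times> UNIV) \<le> emeasure M A"
    "\<And>D. D \<in> sets borel \<Longrightarrow> emeasure \<rho> (UNIV \<times> D) \<le> emeasure N D"
    "emeasure \<rho> (- L) = 0" "ennreal (2/3 * measure M UNIV / 2) \<le> emeasure \<rho> UNIV"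
    using borel_subcoupling[OF M.finite_measure_axioms s(1) N.finite_measure_axioms s(2) L_borel] by metis
  have sp\<rho>: "space \<rho> = UNIV" using \<rho>(1) by (auto dest: sets_eq_imp_space_eq)
  have "emeasure \<rho> UNIV \<noteq> \<infinity>"
    using \<rho>(2)[of UNIV] M.emeasure_finite[of UNIV] by (auto simp: top_unique)
  then interpret R: finite_measure \<rho> by (intro finite_measureI) (simp add: sp\<rho>)
  have [measurable_cong]: "sets \<rho> = sets (borel \<Otimes>\<^sub>M borel)" unfolding borel_prod by (rule \<rho>(1))
  define \<rho>1 where "\<rho>1 = distr \<rho> borel fst"
  define \<rho>2 where "\<rho>2 = distr \<rho> borel snd"
  have \<rho>1: "emeasure \<rho>1 A = emeasure \<rho> (A \<times> UNIV)" if "A \<in> sets borel" for A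
    unfolding \<rho>1_def using that by (subst emeasure_distr) (auto simp: sp\<rho> fst_vimage_eq_Times intro!: arg_cong[where f="emeasure \<rho>"])
  have \<rho>2: "emeasure \<rho>2 D = emeasure \<rho> (UNIV \<times> D)" if "D \<in> sets borel" for D
    unfolding \<rho>2_def using that by (subst emeasure_distr) (auto simp: sp\<rho> snd_vimage_eq_Times intro!: arg_cong[where f="emeasure \<rho>"])
  have fin: "finite_measure \<rho>1" "finite_measure \<rho>2"
    unfolding \<rho>1_def \<rho>2_def by (auto intro!: R.finite_measure_distr)
  define M' where "M' = diff_measure M \<rho>1"
  define N' where "N' = diff_measure N \<rho>2"
  have M': "emeasure M' A = emeasure M A - emeasure \<rho> (A \<times> UNIV)" if "A \<in> sets borel" for A
    unfolding M'_def using that s \<rho>(2)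
    by (subst emeasure_diff_measure[OF M.finite_measure_axioms fin(1)]) (auto simp: \<rho>1 \<rho>1_def[THEN arg_cong[where f=sets]])
  have N': "emeasure N' D = emeasure N D - emeasure \<rho> (UNIV \<times> D)" if "D \<in> sets borel" for D
    unfolding N'_def using that s \<rho>(3)
    by (subst emeasure_diff_measure[OF N.finite_measure_axioms fin(2)]) (auto simp: \<rho>2 \<rho>2_def[THEN arg_cong[where f=sets]])
  have sets': "sets M' = sets borel" "sets N' = sets borel" by (simp_all add: M'_def N'_def s)
  have space': "space M' = UNIV" "space N' = UNIV" by (simp_all add: M'_def N'_def sp)
  have finM': "finite_measure M'"
    using M'[of UNIV] by (intro finite_measureI) (simp add: space' M.emeasure_eq_measure R.emeasure_eq_measure ennreal_minus)
  have finN': "finite_measure N'"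
    using N'[of UNIV] by (intro finite_measureI) (simp add: space' N.emeasure_eq_measure R.emeasure_eq_measure ennreal_minus)
  have le: "measure \<rho> (A \<times> UNIV) \<le> measure M A" "measure \<rho> (UNIV \<times> A) \<le> measure N A"
    if "A \<in> sets borel" for A
    using \<rho>(2)[OF that] \<rho>(3)[OF that]
    by (simp_all add: M.emeasure_eq_measure N.emeasure_eq_measure R.emeasure_eq_measure)
  have mM': "measure M A = measure M' A + measure \<rho> (A \<times> UNIV)" if "A \<in> sets borel" for A
    using M'[OF that] le(1)[OF that]
    by (simp add: measure_def[of M'] M.emeasure_eq_measure R.emeasure_eq_measure ennreal_minus)
  have mN': "measure N D = measure N' D + measure \<rho> (UNIV \<times> D)" if "D \<in> sets borel" for D
    using N'[OF that] le(2)[OF that]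
    by (simp add: measure_def[of N'] N.emeasure_eq_measure R.emeasure_eq_measure ennreal_minus)
  have "measure M' (\<phi> -` S) = measure N' (\<psi> -` S)"
    if S: "S \<in> sets borel" "E `` S \<subseteq> S" for S
  proof -
    have meas: "\<phi> -` S \<in> sets borel" "\<psi> -` S \<in> sets borel"
      using measurable_sets[OF \<phi> S(1)] measurable_sets[OF \<psi> S(1)] by auto
    have "AE z in \<rho>. z \<in> L"
      using \<rho>(4) L_borel \<rho>(1) by (intro AE_I[of _ _ "- L"]) (auto simp: sp\<rho>)
    \<comment> \<open>On \<open>L\<close> an invariant \<open>S\<close> contains
      \<open>\<phi> x\<close> exactly when it contains \<open>\<psi> y\<close>. Subtracting the
      marginals of \<open>\<rho>\<close> thus takes equal amounts from both sides, and the balance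
      survives.\<close>
    then have "AE z in \<rho>. z \<in> (\<phi> -` S) \<times> UNIV \<longleftrightarrow> z \<in> UNIV \<times> (\<psi> -` S)"
    proof eventually_elim
      case (elim z)
      moreover have "(y, x) \<in> E" if "(x, y) \<in> E" for x y using that E(2) by (meson equiv_def symE)
      ultimately show ?case using S(2) unfolding L_def by (cases z) auto
    qed
    then have "measure \<rho> ((\<phi> -` S) \<times> UNIV) = measure \<rho> (UNIV \<times> (\<psi> -` S))"
      using meas by (intro R.finite_measure_eq_AE) auto
    moreover have "measure M (\<phi> -` S) = measure N (\<psi> -` S)" using bal S unfolding balanced_def by blast
    ultimately show ?thesis using mM'[OF meas(1)] mN'[OF meas(2)] by simp
  qed
  then have "balanced M' N'" unfolding balanced_def using finM' finN' sets' by blast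
  moreover have "measure M' UNIV \<le> 2/3 * measure M UNIV"
    using mM'[of UNIV] \<rho>(5) by (simp add: R.emeasure_eq_measure)
  ultimately show ?thesis
    using mM' mN' \<rho>(1,4) R.finite_measure_axioms by (intro exI[of _ M'] exI[of _ N'] exI[of _ \<rho>]) auto
qed

lemma balanced_coupling:
  assumes bal: "balanced M N"
  obtains Q where "sets Q = sets borel" "emeasure Q (- L) = 0"
    "\<And>A. A \<in> sets borel \<Longrightarrow> emeasure Q (A \<times> UNIV) = emeasure M A"
    "\<And>D. D \<in> sets borel \<Longrightarrow> emeasure Q (UNIV \<times> D) = emeasure N D"
proof -
  define step where "step = (\<lambda>(M, N) (M', N') \<rho>. finite_measure \<rho> \<and> sets \<rho> = sets borel \<and> emeasure \<rho> (- L) = 0 \<and>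
    (\<forall>A \<in> sets borel. measure M A = measure M' A + measure \<rho> (A \<times> UNIV)) \<and>
    (\<forall>D \<in> sets borel. measure N D = measure N' D + measure \<rho> (UNIV \<times> D)) \<and>
    measure M' UNIV \<le> 2/3 * measure M UNIV)"
  \<comment> \<open>The clause for \<open>n = 0\<close> builds the starting pair into the invariant,
    since dependent choice leaves the first element free.\<close>
  have "\<exists>F. \<forall>n. (balanced (fst (F n)) (snd (F n)) \<and> (n = 0 \<longrightarrow> F n = (M, N))) \<and> (\<exists>\<rho>. step (F n) (F (Suc n)) \<rho>)"
  proof (rule dependent_nat_choice)
    show "\<exists>Z. balanced (fst Z) (snd Z) \<and> (0 = 0 \<longrightarrow> Z = (M, N))" using bal by auto
    fix Z :: "real measure \<times> real measure" and n :: nat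
    assume "balanced (fst Z) (snd Z) \<and> (n = 0 \<longrightarrow> Z = (M, N))"
    then obtain M' N' \<rho> where "balanced M' N'" "step Z (M', N') \<rho>"
      using balanced_split[of "fst Z" "snd Z"] unfolding step_def case_prod_unfold fst_conv snd_conv by blast
    then show "\<exists>Z'. (balanced (fst Z') (snd Z') \<and> (Suc n = 0 \<longrightarrow> Z' = (M, N))) \<and> (\<exists>\<rho>. step Z Z' \<rho>)"
      by (intro exI[of _ "(M', N')"]) auto
  qed
  then obtain F where F: "\<And>n. balanced (fst (F n)) (snd (F n))" "F 0 = (M, N)" "\<And>n. \<exists>\<rho>. step (F n) (F (Suc n)) \<rho>"
    by blast
  then obtain \<rho> where "\<And>n. step (F n) (F (Suc n)) (\<rho> n)" by metis
  then have \<rho>: "\<And>n. finite_measure (\<rho> n)" "\<And>n. sets (\<rho> n) = sets borel" "\<And>n. emeasure (\<rho> n) (- L) = 0"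
    "\<And>n A. A \<in> sets borel \<Longrightarrow> measure (fst (F n)) A = measure (fst (F (Suc n))) A + measure (\<rho> n) (A \<times> UNIV)"
    "\<And>n D. D \<in> sets borel \<Longrightarrow> measure (snd (F n)) D = measure (snd (F (Suc n))) D + measure (\<rho> n) (UNIV \<times> D)"
    "\<And>n. measure (fst (F (Suc n))) UNIV \<le> 2/3 * measure (fst (F n)) UNIV"
    unfolding step_def case_prod_unfold by blast+
  have fin: "finite_measure (fst (F n))" "finite_measure (snd (F n))"
    and bsets: "sets (fst (F n)) = sets borel" "sets (snd (F n)) = sets borel" for n
    using F(1)[of n] by (auto simp: balanced_def)
  have decay: "measure (fst (F n)) UNIV \<le> (2/3) ^ n * measure M UNIV" for n
  proof (induction n)
    case (Suc n)
    then show ?case using \<rho>(6)[of n] by simp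
  qed (simp add: F)
  have "(\<lambda>n. (2/3) ^ n :: real) \<longlonglongrightarrow> 0" by (intro LIMSEQ_power_zero) auto
  then have "(\<lambda>n. (2/3) ^ n * measure M UNIV) \<longlonglongrightarrow> 0" by (rule tendsto_mult_left_zero)
  then have lim: "(\<lambda>n. measure (fst (F n)) UNIV) \<longlonglongrightarrow> 0"
    by (rule tendsto_sandwich[OF _ _ tendsto_const, rotated -1]) (use decay in auto)
  \<comment> \<open>The decay is known for the first components; equality of the totals carries it
    over to the second ones.\<close>
  have mass_eq: "measure (fst (F n)) UNIV = measure (snd (F n)) UNIV" for n
    using F(1)[of n] unfolding balanced_def by (elim conjE) (drule bspec[of _ _ UNIV]; simp)
  have lim1: "(\<lambda>n. measure (fst (F n)) A) \<longlonglongrightarrow> 0" if "A \<in> sets borel" for A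
    by (rule tendsto_sandwich[OF _ _ tendsto_const lim])
       (use that finite_measure.finite_measure_mono[OF fin(1), of A UNIV] bsets in auto)
  have lim2: "(\<lambda>n. measure (snd (F n)) A) \<longlonglongrightarrow> 0" if "A \<in> sets borel" for A
    by (rule tendsto_sandwich[OF _ _ tendsto_const lim])
       (use that finite_measure.finite_measure_mono[OF fin(2), of A UNIV] bsets in \<open>auto simp: mass_eq\<close>)
  \<comment> \<open>Each subcoupling accounts for the drop of the remainder \<open>m\<close> in its
    step. The series telescopes, and nothing is left because the remainders tend to 0.\<close>
  have series: "(\<Sum>n. emeasure (\<rho> n) S) = emeasure K A"
    if K: "finite_measure K" and tel: "\<And>n. m n = m (Suc n) + measure (\<rho> n) S" "m 0 = measure K A" "m \<longlonglongrightarrow> 0"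
    for m :: "nat \<Rightarrow> real" and S A and K :: "real measure"
  proof -
    have "(\<lambda>n. m n - m (Suc n)) sums (m 0 - 0)" by (rule telescope_sums'[OF tel(3)])
    moreover have "m n - m (Suc n) = measure (\<rho> n) S" for n using tel(1)[of n] by simp
    ultimately have "(\<lambda>n. measure (\<rho> n) S) sums measure K A" by (simp add: tel(2))
    then have "(\<lambda>n. ennreal (measure (\<rho> n) S)) sums ennreal (measure K A)" by simp
    then show ?thesis
      using finite_measure.emeasure_eq_measure[OF \<rho>(1)] finite_measure.emeasure_eq_measure[OF K]
      by (simp add: sums_iff)
  qed
  obtain Q where Q: "sets Q = sets borel" "\<And>S. S \<in> sets borel \<Longrightarrow> emeasure Q S = (\<Sum>n. emeasure (\<rho> n) S)"
    using measure_series[of \<rho> borel] \<rho>(2) by blast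
  show ?thesis
  proof (rule that[of Q])
    show "emeasure Q (- L) = 0" using Q(2)[of "- L"] L_borel \<rho>(3) by auto
    show "emeasure Q (A \<times> UNIV) = emeasure M A" if "A \<in> sets borel" for A
    proof -
      have "A \<times> UNIV \<in> sets (borel :: (real \<times> real) measure)" using that unfolding borel_prod[symmetric] by auto
      moreover have "(\<Sum>n. emeasure (\<rho> n) (A \<times> UNIV)) = emeasure M A"
      proof (rule series[where m="\<lambda>n. measure (fst (F n)) A"])
        show "finite_measure M" using bal by (simp add: balanced_def)
      qed (rule \<rho>(4)[OF that], simp only: F(2) fst_conv, rule lim1[OF that])
      ultimately show ?thesis by (simp add: Q(2))
    qed
    show "emeasure Q (UNIV \<times> D) = emeasure N D" if "D \<in> sets borel" for D
    proof -
      have "UNIV \<times> D \<in> sets (borel :: (real \<times> real) measure)" using that unfolding borel_prod[symmetric] by auto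
      moreover have "(\<Sum>n. emeasure (\<rho> n) (UNIV \<times> D)) = emeasure N D"
      proof (rule series[where m="\<lambda>n. measure (snd (F n)) D"])
        show "finite_measure N" using bal by (simp add: balanced_def)
      qed (rule \<rho>(5)[OF that], simp only: F(2) snd_conv, rule lim2[OF that])
      ultimately show ?thesis by (simp add: Q(2))
    qed
  qed (rule Q(1))
qed

end

section \<open>Standard probability spaces\<close>

text \<open>The parametrisation of a standard space is measurable only for the completion of its
  model, so the projections of a coupling must preserve measure between completions too. They do
  because preimages of null sets are null, and a completed-measurable set differs from its
  \<open>main_part\<close> by a null set.\<close>

lemma distr_completion_eq:
  assumes f: "f \<in> Q \<rightarrow>\<^sub>M \<mu>" and d: "distr Q \<mu> f = \<mu>"
  shows "f \<in> completion Q \<rightarrow>\<^sub>M completion \<mu>" "distr (completion Q) (completion \<mu>) f = completion \<mu>"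
proof -
  have "null_sets \<mu> \<subseteq> null_sets (distr (completion Q) \<mu> f)"
    using d distr_completion[OF f] by simp
  then show m: "f \<in> completion Q \<rightarrow>\<^sub>M completion \<mu>"
    by (intro completion.measurable_completion2 measurable_completion f)
  show "distr (completion Q) (completion \<mu>) f = completion \<mu>"
  proof (rule measure_eqI)
    fix T assume "T \<in> sets (distr (completion Q) (completion \<mu>) f)"
    then have T: "T \<in> sets (completion \<mu>)" by simp
    define S where "S = main_part \<mu> T"
    have S: "S \<in> sets \<mu>" using T by (simp add: S_def)
    have "AE x in \<mu>. x \<notin> null_part \<mu> T" using T by (rule AE_notin_null_part)
    then have "AE x in \<mu>. x \<in> T \<longleftrightarrow> x \<in> S"
    proof eventually_elim
      case (elim x)
      then show ?case using main_part_null_part_Un[OF T] unfolding S_def by blast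
    qed
    then have "AE x in distr Q \<mu> f. x \<in> T \<longleftrightarrow> x \<in> S" unfolding d .
    then have "AE z in Q. f z \<in> T \<longleftrightarrow> f z \<in> S" by (rule AE_distrD[OF f])
    then have "AE z in completion Q. z \<in> f -` T \<inter> space Q \<longleftrightarrow> z \<in> f -` S \<inter> space Q"
      unfolding AE_completion_iff by eventually_elim auto
    then have "emeasure (completion Q) (f -` T \<inter> space Q) = emeasure (completion Q) (f -` S \<inter> space Q)"
      using measurable_sets[OF m T] measurable_sets[OF f S] by (intro emeasure_eq_AE) auto
    also have "\<dots> = emeasure Q (f -` S \<inter> space Q)"
      using measurable_sets[OF f S] by simp
    also have "\<dots> = emeasure (distr Q \<mu> f) S" using f S by (simp add: emeasure_distr)
    also have "\<dots> = emeasure (completion \<mu>) T" unfolding d using T by (simp add: S_def)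
    finally show "emeasure (distr (completion Q) (completion \<mu>) f) T = emeasure (completion \<mu>) T"
      using m T by (simp add: emeasure_distr)
  qed simp
qed

text \<open>\<open>Y\<close> composed with \<open>g\<close> is measurable only for the completion of
  \<open>\<mu>\<close>; \<open>\<phi>\<close> is a Borel version of it. This exact Borel
  measurability is what the Borel set \<open>L\<close> and the separation argument rely on.\<close>

lemma standard_prob_space_real_model:
  assumes M: "standard_prob_space M" and Y: "Y \<in> borel_measurable M"
  obtains \<mu> :: "real measure" and g \<phi> where
    "prob_space \<mu>" "sets \<mu> = sets borel" "g \<in> completion \<mu> \<rightarrow>\<^sub>M M" "distr (completion \<mu>) M g = M"
    "\<phi> \<in> borel_measurable borel" "AE x in \<mu>. Y (g x) = (\<phi> x :: real)"
    "\<And>S. S \<in> sets borel \<Longrightarrow> measure M (Y -` S \<inter> space M) = measure \<mu> (\<phi> -` S)"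
proof -
  obtain \<mu> :: "real measure" and g where \<mu>: "prob_space \<mu>" "sets \<mu> = sets borel"
    and g: "g \<in> completion \<mu> \<rightarrow>\<^sub>M M" "distr (completion \<mu>) M g = M"
    using M unfolding standard_prob_space_def by blast
  have "(\<lambda>x. Y (g x)) \<in> borel_measurable (completion \<mu>)" using measurable_compose[OF g(1) Y] .
  then obtain \<phi> where \<phi>: "\<phi> \<in> borel_measurable \<mu>" "AE x in \<mu>. Y (g x) = \<phi> x"
    using completion_ex_borel_measurable_real by blast
  have \<phi>': "\<phi> \<in> borel_measurable borel" using \<phi>(1) measurable_cong_sets[OF \<mu>(2) refl] by blast
  have sp: "space \<mu> = UNIV" using \<mu>(2) by (auto dest: sets_eq_imp_space_eq)
  have "measure M (Y -` S \<inter> space M) = measure \<mu> (\<phi> -` S)" if S: "S \<in> sets borel" for S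
  proof -
    have YS: "Y -` S \<inter> space M \<in> sets M" using Y S by (rule measurable_sets)
    have \<phi>S: "\<phi> -` S \<in> sets \<mu>" using measurable_sets[OF \<phi>(1) S] by (simp add: sp)
    have "emeasure M (Y -` S \<inter> space M) = emeasure (distr (completion \<mu>) M g) (Y -` S \<inter> space M)"
      by (simp only: g(2))
    also have "\<dots> = emeasure (completion \<mu>) (g -` (Y -` S \<inter> space M) \<inter> space (completion \<mu>))"
      using g(1) YS by (rule emeasure_distr)
    also have "\<dots> = emeasure (completion \<mu>) (\<phi> -` S)"
    proof (rule emeasure_eq_AE)
      have gs: "g x \<in> space M" for x using measurable_space[OF g(1), of x] by (simp add: sp)
      show "AE x in completion \<mu>. x \<in> g -` (Y -` S \<inter> space M) \<inter> space (completion \<mu>) \<longleftrightarrow> x \<in> \<phi> -` S"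
        using AE_completion[OF \<phi>(2)] by eventually_elim (simp add: gs sp)
      show "g -` (Y -` S \<inter> space M) \<inter> space (completion \<mu>) \<in> sets (completion \<mu>)"
        using g(1) YS by (rule measurable_sets)
    qed (use \<phi>S in auto)
    also have "\<dots> = emeasure \<mu> (\<phi> -` S)" using \<phi>S by simp
    finally show ?thesis by (simp add: measure_def)
  qed
  then show ?thesis using that[OF \<mu> g \<phi>' \<phi>(2)] by blast
qed

text \<open>The bridge between the two sides: equality of laws is stated for members of the
  sigma-field on \<open>V\<close>, balance for invariant Borel sets on the line. A generating plot
  suffices to test membership, as every other plot factors through it by a Borel function.\<close>

lemma borelogy_sigma_image:
  fixes b :: "real \<Rightarrow> 'v"
  assumes b: "range b = V" "B = {b \<circ> f | f. f \<in> borel_measurable (borel :: real measure)}"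
    and S: "S \<in> sets borel" "{(x, y). b x = b y} `` S \<subseteq> S"
  shows "b ` S \<in> borelogy_sigma V B" "b -` (b ` S) = S"
proof -
  show inv: "b -` (b ` S) = S" using S(2) by force
  have "(b \<circ> f) -` (b ` S) \<in> sets borel" if "f \<in> borel_measurable borel" for f :: "real \<Rightarrow> real"
    unfolding vimage_comp[symmetric] inv using measurable_sets[OF that S(1)] by simp
  then show "b ` S \<in> borelogy_sigma V B" using b by (auto simp: borelogy_sigma_def)
qed

theorem theorem8p2:
  fixes M1 :: "'a measure" and M2 :: "'b measure"
    and V :: "'v set" and B :: "(real \<Rightarrow> 'v) set"
    and X1 :: "'a \<Rightarrow> 'v" and X2 :: "'b \<Rightarrow> 'v"
  assumes "standard_prob_space M1" and "standard_prob_space M2"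
    and "borelogy V B"
    and "borelogy_rv V B M1 X1" and "borelogy_rv V B M2 X2"
  shows "(\<forall>A \<in> borelogy_sigma V B.
            measure M1 {\<omega> \<in> space M1. X1 \<omega> \<in> A} = measure M2 {\<omega> \<in> space M2. X2 \<omega> \<in> A})
         \<longleftrightarrow>
         (\<exists>P :: ('a \<times> 'b) measure. prob_space P \<and> sets P = sets (M1 \<Otimes>\<^sub>M M2) \<and>
            distr P M1 fst = M1 \<and> distr P M2 snd = M2 \<and>
            (AE z in P. X1 (fst z) = X2 (snd z)))"
proof -
  obtain b where b: "b \<in> B" "range b = V" "B = {b \<circ> f | f. f \<in> borel_measurable (borel :: real measure)}"
    using assms(3) unfolding borelogy_def by blast
  define E where "E = {(x, y). b x = b y}"
  have E_borel: "E \<in> sets borel" using assms(3) b(1) unfolding borelogy_def E_def by blast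
  \<comment> \<open>Both variables are rewritten through the same generating plot \<open>b\<close>,
    so that equality in \<open>V\<close> becomes the single relation \<open>E\<close> on real
    representatives.\<close>
  have lift: "\<exists>Y. Y \<in> borel_measurable M \<and> (\<forall>\<omega>\<in>space M. X \<omega> = b (Y \<omega>))"
    if rv: "borelogy_rv V B M X" for M :: "'c measure" and X
  proof -
    obtain b' Y where Y: "b' \<in> B" "Y \<in> borel_measurable M" "\<forall>\<omega>\<in>space M. X \<omega> = b' (Y \<omega>)"
      using rv unfolding borelogy_rv_def by blast
    from Y(1) obtain f where "f \<in> borel_measurable borel" "b' = b \<circ> f" unfolding b(3) by blast
    then show ?thesis using Y(2,3) by (intro exI[of _ "\<lambda>\<omega>. f (Y \<omega>)"]) (auto intro: measurable_compose)
  qed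
  obtain Y1 where Y1: "Y1 \<in> borel_measurable M1" "\<And>\<omega>. \<omega> \<in> space M1 \<Longrightarrow> X1 \<omega> = b (Y1 \<omega>)"
    using lift[OF assms(4)] by blast
  obtain Y2 where Y2: "Y2 \<in> borel_measurable M2" "\<And>\<omega>. \<omega> \<in> space M2 \<Longrightarrow> X2 \<omega> = b (Y2 \<omega>)"
    using lift[OF assms(5)] by blast
  have ev1: "{\<omega> \<in> space M1. X1 \<omega> \<in> A} = Y1 -` (b -` A) \<inter> space M1" for A using Y1(2) by auto
  have ev2: "{\<omega> \<in> space M2. X2 \<omega> \<in> A} = Y2 -` (b -` A) \<inter> space M2" for A using Y2(2) by auto
  show ?thesis (is "?a \<longleftrightarrow> ?b")
  proof
    assume ?b
    then obtain P :: "('a \<times> 'b) measure" where P: "prob_space P" "sets P = sets (M1 \<Otimes>\<^sub>M M2)"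
      "distr P M1 fst = M1" "distr P M2 snd = M2" "AE z in P. X1 (fst z) = X2 (snd z)" by blast
    have [measurable]: "fst \<in> P \<rightarrow>\<^sub>M M1" "snd \<in> P \<rightarrow>\<^sub>M M2"
      using measurable_cong_sets[OF P(2) refl] measurable_fst measurable_snd by blast+
    have spP: "space P = space M1 \<times> space M2"
      using sets_eq_imp_space_eq[OF P(2)] by (simp add: space_pair_measure)
    show ?a
    proof
      fix A assume "A \<in> borelogy_sigma V B"
      then have A: "b -` A \<in> sets borel" using b(1) by (auto simp: borelogy_sigma_def)
      have [measurable]: "{\<omega> \<in> space M1. X1 \<omega> \<in> A} \<in> sets M1" "{\<omega> \<in> space M2. X2 \<omega> \<in> A} \<in> sets M2"
        unfolding ev1 ev2 using measurable_sets[OF Y1(1) A] measurable_sets[OF Y2(1) A] .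
      have "emeasure M1 {\<omega> \<in> space M1. X1 \<omega> \<in> A} = emeasure (distr P M1 fst) {\<omega> \<in> space M1. X1 \<omega> \<in> A}"
        by (simp only: P(3))
      also have "\<dots> = emeasure P (fst -` {\<omega> \<in> space M1. X1 \<omega> \<in> A} \<inter> space P)"
        by (rule emeasure_distr) measurable
      also have "\<dots> = emeasure P (snd -` {\<omega> \<in> space M2. X2 \<omega> \<in> A} \<inter> space P)"
      proof (rule emeasure_eq_AE)
        show "AE z in P. z \<in> fst -` {\<omega> \<in> space M1. X1 \<omega> \<in> A} \<inter> space P \<longleftrightarrow>
            z \<in> snd -` {\<omega> \<in> space M2. X2 \<omega> \<in> A} \<inter> space P"
          using P(5) by eventually_elim (auto simp: spP)
      qed measurable
      also have "\<dots> = emeasure (distr P M2 snd) {\<omega> \<in> space M2. X2 \<omega> \<in> A}"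
        by (rule emeasure_distr[symmetric]) measurable
      also have "\<dots> = emeasure M2 {\<omega> \<in> space M2. X2 \<omega> \<in> A}" by (simp only: P(4))
      finally show "measure M1 {\<omega> \<in> space M1. X1 \<omega> \<in> A} = measure M2 {\<omega> \<in> space M2. X2 \<omega> \<in> A}"
        by (simp add: measure_def)
    qed
  next
    assume a: ?a
    obtain \<mu> :: "real measure" and g1 \<phi> where m1: "prob_space \<mu>" "sets \<mu> = sets borel"
      "g1 \<in> completion \<mu> \<rightarrow>\<^sub>M M1" "distr (completion \<mu>) M1 g1 = M1"
      "\<phi> \<in> borel_measurable borel" "AE x in \<mu>. Y1 (g1 x) = \<phi> x"
      "\<And>S. S \<in> sets borel \<Longrightarrow> measure M1 (Y1 -` S \<inter> space M1) = measure \<mu> (\<phi> -` S)"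
      by (rule standard_prob_space_real_model[OF assms(1) Y1(1)]) (rule that)
    obtain \<nu> :: "real measure" and g2 \<psi> where m2: "prob_space \<nu>" "sets \<nu> = sets borel"
      "g2 \<in> completion \<nu> \<rightarrow>\<^sub>M M2" "distr (completion \<nu>) M2 g2 = M2"
      "\<psi> \<in> borel_measurable borel" "AE x in \<nu>. Y2 (g2 x) = \<psi> x"
      "\<And>S. S \<in> sets borel \<Longrightarrow> measure M2 (Y2 -` S \<inter> space M2) = measure \<nu> (\<psi> -` S)"
      by (rule standard_prob_space_real_model[OF assms(2) Y2(1)]) (rule that)
    interpret \<mu>: prob_space \<mu> by fact
    interpret \<nu>: prob_space \<nu> by fact
    interpret fibre_product E \<phi> \<psi>
      using E_borel m1(5) m2(5) by unfold_locales (auto simp: E_def equiv_def refl_on_def sym_def trans_def)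
    have "measure \<mu> (\<phi> -` S) = measure \<nu> (\<psi> -` S)" if S: "S \<in> sets borel" "E `` S \<subseteq> S" for S
    proof -
      note bS = borelogy_sigma_image[OF b(2,3) S(1) S(2)[unfolded E_def]]
      from a bS(1) have "measure M1 {\<omega> \<in> space M1. X1 \<omega> \<in> b ` S} = measure M2 {\<omega> \<in> space M2. X2 \<omega> \<in> b ` S}"
        by blast
      then show ?thesis unfolding ev1 ev2 bS(2) m1(7)[OF S(1)] m2(7)[OF S(1)] .
    qed
    then have "balanced \<mu> \<nu>"
      unfolding balanced_def using m1(2) m2(2) \<mu>.finite_measure_axioms \<nu>.finite_measure_axioms by blast
    then obtain Q where Q: "sets Q = sets borel" "emeasure Q (- L) = 0"
      "\<And>A. A \<in> sets borel \<Longrightarrow> emeasure Q (A \<times> UNIV) = emeasure \<mu> A"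
      "\<And>D. D \<in> sets borel \<Longrightarrow> emeasure Q (UNIV \<times> D) = emeasure \<nu> D"
      by (rule balanced_coupling) (rule that)
    have sp: "space Q = UNIV" "space \<mu> = UNIV" "space \<nu> = UNIV"
      using Q(1) m1(2) m2(2) by (auto dest: sets_eq_imp_space_eq)
    have Qs: "sets Q = sets (borel \<Otimes>\<^sub>M borel)" unfolding borel_prod by (rule Q(1))
    have fst: "fst \<in> Q \<rightarrow>\<^sub>M \<mu>"
      unfolding measurable_cong_sets[OF Qs m1(2)] by (rule measurable_fst)
    have snd: "snd \<in> Q \<rightarrow>\<^sub>M \<nu>"
      unfolding measurable_cong_sets[OF Qs m2(2)] by (rule measurable_snd)
    have d1: "distr Q \<mu> fst = \<mu>"
    proof (rule measure_eqI)
      fix A assume "A \<in> sets (distr Q \<mu> fst)"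
      then have "A \<in> sets \<mu>" "A \<in> sets borel" using m1(2) by auto
      moreover have "fst -` A \<inter> space Q = A \<times> UNIV" by (auto simp: sp)
      ultimately show "emeasure (distr Q \<mu> fst) A = emeasure \<mu> A"
        using Q(3) by (simp add: emeasure_distr[OF fst])
    qed simp
    have d2: "distr Q \<nu> snd = \<nu>"
    proof (rule measure_eqI)
      fix D assume "D \<in> sets (distr Q \<nu> snd)"
      then have "D \<in> sets \<nu>" "D \<in> sets borel" using m2(2) by auto
      moreover have "snd -` D \<inter> space Q = UNIV \<times> D" by (auto simp: sp)
      ultimately show "emeasure (distr Q \<nu> snd) D = emeasure \<nu> D"
        using Q(4) by (simp add: emeasure_distr[OF snd])
    qed simp
    note c1 = distr_completion_eq[OF fst d1] and c2 = distr_completion_eq[OF snd d2]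
    \<comment> \<open>The coupling on the plane is carried back by both parametrisations. Its domain
      is the completion of \<open>Q\<close>, because \<open>g1\<close> and \<open>g2\<close> are
      measurable only for completed measures.\<close>
    define G where "G z = (g1 (fst z), g2 (snd z))" for z
    have h1: "(\<lambda>z. g1 (fst z)) \<in> completion Q \<rightarrow>\<^sub>M M1" using measurable_compose[OF c1(1) m1(3)] .
    have h2: "(\<lambda>z. g2 (snd z)) \<in> completion Q \<rightarrow>\<^sub>M M2" using measurable_compose[OF c2(1) m2(3)] .
    have G: "G \<in> completion Q \<rightarrow>\<^sub>M M1 \<Otimes>\<^sub>M M2" unfolding G_def using h1 h2 by (rule measurable_Pair)
    define P where "P = distr (completion Q) (M1 \<Otimes>\<^sub>M M2) G"
    have Pfst: "distr P M1 fst = M1"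
    proof -
      have "distr P M1 fst = distr (completion Q) M1 (\<lambda>z. g1 (fst z))"
        unfolding P_def by (subst distr_distr[OF measurable_fst G]) (simp add: G_def o_def)
      also have "\<dots> = distr (distr (completion Q) (completion \<mu>) fst) M1 g1"
        by (subst distr_distr[OF m1(3) c1(1)]) (simp add: o_def)
      finally show ?thesis unfolding c1(2) m1(4) .
    qed
    have Psnd: "distr P M2 snd = M2"
    proof -
      have "distr P M2 snd = distr (completion Q) M2 (\<lambda>z. g2 (snd z))"
        unfolding P_def by (subst distr_distr[OF measurable_snd G]) (simp add: G_def o_def)
      also have "\<dots> = distr (distr (completion Q) (completion \<nu>) snd) M2 g2"
        by (subst distr_distr[OF m2(3) c2(1)]) (simp add: o_def)
      finally show ?thesis unfolding c2(2) m2(4) .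
    qed
    have "prob_space Q"
      using Q(3)[of UNIV] \<mu>.emeasure_space_1 by (intro prob_spaceI) (simp add: sp)
    then have "prob_space (completion Q)" by (rule prob_space.prob_space_completion)
    then have prob: "prob_space P" unfolding P_def by (rule prob_space.prob_space_distr) (rule G)
    have "AE z in P. X1 (fst z) = X2 (snd z)"
    proof -
      \<comment> \<open>Moving an almost-sure statement through \<open>distr\<close> requires a
        measurable event. Equality of the values in \<open>V\<close> is therefore expressed by the
        representatives \<open>Y1\<close>, \<open>Y2\<close> and the Borel set
        \<open>E\<close>.\<close>
      have E': "E \<in> sets (borel \<Otimes>\<^sub>M borel)" using E_borel unfolding borel_prod .
      have "(\<lambda>z. (Y1 (fst z), Y2 (snd z))) \<in> M1 \<Otimes>\<^sub>M M2 \<rightarrow>\<^sub>M borel \<Otimes>\<^sub>M borel"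
        using Y1(1) Y2(1) by measurable
      from measurable_sets[OF this E']
      have meas: "{z \<in> space (M1 \<Otimes>\<^sub>M M2). (Y1 (fst z), Y2 (snd z)) \<in> E} \<in> sets (M1 \<Otimes>\<^sub>M M2)"
        by (simp add: vimage_def Int_def conj_commute)
      have "AE z in Q. Y1 (g1 (fst z)) = \<phi> (fst z)" by (rule AE_distrD[OF fst]) (unfold d1, rule m1(6))
      moreover have "AE z in Q. Y2 (g2 (snd z)) = \<psi> (snd z)" by (rule AE_distrD[OF snd]) (unfold d2, rule m2(6))
      moreover have "AE z in Q. z \<in> L"
        using Q(1,2) L_borel by (intro AE_I[of _ _ "- L"]) (auto simp: sp)
      ultimately have "AE z in Q. (Y1 (fst (G z)), Y2 (snd (G z))) \<in> E"
        by eventually_elim (auto simp: G_def L_def)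
      then have "AE z in P. (Y1 (fst z), Y2 (snd z)) \<in> E"
        unfolding P_def AE_distr_iff[OF G meas] by (rule AE_completion)
      moreover have "AE z in P. z \<in> space (M1 \<Otimes>\<^sub>M M2)"
        using AE_space[of P] by (simp add: P_def)
      ultimately show ?thesis
        by eventually_elim (auto simp: Y1(2) Y2(2) E_def space_pair_measure)
    qed
    then show ?b
      using prob Pfst Psnd by (intro exI[of _ P]) (simp add: P_def)
  qed
qed

end
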